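(* Let $\lambda_1,\lambda_2>0$, let $W\sim \mathrm{Skellam}(\lambda_1,\lambda_2)$, let $\nu\in\mathbb{N}=\{0,1,2,\dots\}$, and put $\alpha_0=-\log(\sqrt2-1)$, $x=2\sqrt{\lambda_1\lambda_2}$ and $$C=\left(\sqrt{\frac{\lambda_1}{\lambda_2}}\right)^{\nu}\exp\left[-\left(\sqrt{\lambda_1}-\sqrt{\lambda_2}\right)^2\right].$$ Let $\mathcal{L}(0,x)$ and $\mathcal{U}(0,x)$ be the explicit quantities defined in the context. (1) If $\nu\leq x$, then $$C\,\frac{\exp\left(-\frac{\nu(\nu+1)}{2x}\right)}{1+2\,\mathcal{U}(0,x)}\leq \mathbb{P}[W=\nu]\leq C\,\frac{\exp\left(-\frac{\alpha_0}{2x}\nu^2\right)}{1+2\,\mathcal{L}(0,x)}.$$ (2) If $\nu>x$, then $$C\,\frac{e^{-\frac{[x]([x]+1)}{2x}}\,B\left([x]+\frac x2+1,\nu-[x]\right)\frac{(x/2)^{\nu-[x]}}{(\nu-[x]-1)!}}{1+2\,\mathcal{U}(0,x)}\leq \mathbb{P}[W=\nu]\leq C\,\frac{e^{-\frac{\alpha_0}{2x}[x]^2}\,B\left([x]+x+\frac12,\nu-[x]\right)\frac{x^{\nu-[x]}}{(\nu-[x]-1)!}}{1+2\,\mathcal{L}(0,x)}.$$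
   Context: $W\sim\mathrm{Skellam}(\lambda_1,\lambda_2)$ means that $W$ is distributed as $X_1-X_2$ with $X_1\sim\mathrm{Pois}(\lambda_1)$ and $X_2\sim\mathrm{Pois}(\lambda_2)$ independent; equivalently $\mathbb{P}[W=n]=e^{-(\lambda_1+\lambda_2)}\left(\frac{\lambda_1}{\lambda_2}\right)^{n/2}I_{|n|}(2\sqrt{\lambda_1\lambda_2})$ for $n\in\mathbb{Z}$, where $I_{\nu}(x)=\sum_{k=0}^{\infty}\frac{1}{k!\,\Gamma(k+\nu+1)}\left(\frac{x}{2}\right)^{2k+\nu}$ is the modified Bessel function of the first kind. $B(\cdot,\cdot)$ is the Beta function; $[x]$ is the floor of $x$; $\log$ is the natural logarithm. Put $F(\nu,x)=\frac{x}{\nu+\sqrt{\nu^2+x^2}}$. If $[x]\geq 2$: $$\mathcal{L}(0,x)=\frac{2x\,e^{-\frac1x}}{\frac32+\sqrt{\frac94+4x}}-\frac{2x\,e^{-\frac{1}{2x}([x]+1)([x]+2)}}{[x]+\frac32+\sqrt{\left([x]+\frac32\right)^2+\frac{8x}{\pi}}}+e^{-\frac{([x]-1)[x]}{2x}}F([x],x)\bigl(1+F([x]+1,x)\bigr),$$ $$\mathcal{U}(0,x)=\frac{2x}{\alpha_0}\left[\frac{1}{\sqrt{\frac{8x}{\pi\alpha_0}}}-\frac{e^{-\frac{\alpha_0x}{2}}}{x+\sqrt{x^2+\frac{4x}{\alpha_0}}}\right]+e^{-\frac{\alpha_0}{2x}([x]-1)^2}\,\frac{F\left([x]-\frac12,x\right)}{1-F\left([x]+\frac12,x\right)}.$$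 If $[x]<2$: $$\mathcal{L}(0,x)=F(1,x)\bigl(1+F(2,x)\bigr),\qquad \mathcal{U}(0,x)=\frac{F\left(\frac12,x\right)}{1-F\left(\frac32,x\right)}.$$ *)

theory Defs
  imports "HOL-Probability.Probability"
begin

text \<open>
  The Skellam distribution: the law of \<open>X\<^sub>1 - X\<^sub>2\<close> for independent Poisson variables
  \<open>X\<^sub>1\<close>, \<open>X\<^sub>2\<close>. Since \<^const>\<open>poisson_pmf\<close> is only meaningful for positive rates, so is
  this definition.
\<close>

definition skellam_pmf :: "real \<Rightarrow> real \<Rightarrow> int pmf" where
  "skellam_pmf lam1 lam2 =
     map_pmf (\<lambda>(m, n). int m - int n) (pair_pmf (poisson_pmf lam1) (poisson_pmf lam2))"

definition alpha0 :: real where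
  "alpha0 = - ln (sqrt 2 - 1)"

definition F :: "real \<Rightarrow> real \<Rightarrow> real" where
  "F \<nu> x = x / (\<nu> + sqrt (\<nu>\<^sup>2 + x\<^sup>2))"

text \<open>
  The quantities \<open>\<L>(0,x)\<close> and \<open>\<U>(0,x)\<close>, for \<open>x > 0\<close>; the value \<open>0\<close> of the first argument
  is built into the formulas.
\<close>

definition L0 :: "real \<Rightarrow> real" where
  "L0 x = (let n = real_of_int \<lfloor>x\<rfloor> in
     if \<lfloor>x\<rfloor> \<ge> 2 then
       2 * x * exp (- 1 / x) / (3 / 2 + sqrt (9 / 4 + 4 * x))
       - 2 * x * exp (- (1 / (2 * x)) * (n + 1) * (n + 2))
           / (n + 3 / 2 + sqrt ((n + 3 / 2)\<^sup>2 + 8 * x / pi))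
       + exp (- ((n - 1) * n / (2 * x))) * F n x * (1 + F (n + 1) x)
     else F 1 x * (1 + F 2 x))"

definition U0 :: "real \<Rightarrow> real" where
  "U0 x = (let n = real_of_int \<lfloor>x\<rfloor> in
     if \<lfloor>x\<rfloor> \<ge> 2 then
       2 * x / alpha0 *
         (1 / sqrt (8 * x / (pi * alpha0))
          - exp (- (alpha0 * x / 2)) / (x + sqrt (x\<^sup>2 + 4 * x / alpha0)))
       + exp (- (alpha0 / (2 * x)) * (n - 1)\<^sup>2) * (F (n - 1 / 2) x / (1 - F (n + 1 / 2) x))
     else F (1 / 2) x / (1 - F (3 / 2) x))"

end

theory Submission
  imports Defs
begin

text \<open>
  With \<open>x = 2\<surd>(\<lambda>\<^sub>1\<lambda>\<^sub>2)\<close> one has \<open>P[W = \<nu>] = C e\<^sup>-\<^sup>x I\<^sub>\<nu>(x)\<close>, and \<open>e\<^sup>x = I\<^sub>0(x) (1 + 2 H)\<close> where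
  \<open>H = \<Sum>\<^sub>n\<^sub>\<ge>\<^sub>1 I\<^sub>n(x) / I\<^sub>0(x)\<close>. Hence \<open>P[W = \<nu>] = C (I\<^sub>\<nu>(x) / I\<^sub>0(x)) / (1 + 2 H)\<close>, and everything
  follows from Amos' bounds \<open>F(k,x) \<le> I\<^sub>k(x) / I\<^sub>k\<^sub>-\<^sub>1(x) \<le> F(k - 1/2,x)\<close>: multiplying them up bounds
  \<open>I\<^sub>\<nu> / I\<^sub>0\<close>, and summing the products gives \<open>\<L>(0,x) \<le> H \<le> \<U>(0,x)\<close>. The exponentials come from
  \<open>F(a,x) = exp (- arsinh (a / x))\<close> and \<open>\<alpha>\<^sub>0 s \<le> arsinh s \<le> s\<close> for \<open>s \<in> [0,1]\<close>.
\<close>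

section \<open>Ratios of modified Bessel functions\<close>

text \<open>\<open>F a x\<close> is the positive root of x r^2 + 2 a r = x. Amos' bounds on r =
  I_{j+1}(x) / I_j(x) are therefore two quadratic inequalities between power series, with 2a = 2j +
  2 and 2a = 2j + 1, and they can be decided coefficient by coefficient. The constant
  \<open>alpha0\<close> is arsinh 1, the slope of the chord of arsinh over [0,1]. Since arsinh is
  concave on the positive axis, this chord lies below it only on that interval, that is, for a \<le>
  x. This forces the case split at x: past [x] the factors F(a,x) are estimated by (x/2) / (a + x/2)
  and x / (a + x), whose products are the Beta factors of the statement. In \<open>U0\<close> the
  bracket is a Gaussian integral with a bound for its tail removed, and the last summand is a
  geometric series. The delicate point is the difference of the first two terms of
  \<open>L0\<close>, where the margin is small for [x] = 2.\<close>

definition bessel_coeff :: "nat \<Rightarrow> nat \<Rightarrow> real" where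
  "bessel_coeff n m = 1 / (fact m * fact (m + n))"

text \<open>Taking (x/2)^n out of the Bessel series leaves an ordinary power series in y = (x/2)^2,
  so that Cauchy products apply directly.\<close>

definition bessel_S :: "nat \<Rightarrow> real \<Rightarrow> real" where
  "bessel_S n y = (\<Sum>m. bessel_coeff n m * y ^ m)"

definition bessel_I :: "nat \<Rightarrow> real \<Rightarrow> real" where
  "bessel_I n x = (x / 2) ^ n * bessel_S n ((x / 2)\<^sup>2)"

lemma bessel_coeff_pos: "bessel_coeff n m > 0"
  by (simp add: bessel_coeff_def)

lemma summable_bessel_S:
  assumes "y \<ge> 0"
  shows "summable (\<lambda>m. bessel_coeff n m * y ^ m)"
proof (rule summable_comparison_test)
  show "\<exists>N. \<forall>m\<ge>N. norm (bessel_coeff n m * y ^ m) \<le> y ^ m /\<^sub>R fact m"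
  proof (intro exI allI impI)
    fix m :: nat
    have "fact m * 1 \<le> (fact m * fact (m + n) :: real)"
      by (intro mult_left_mono) auto
    then have "y ^ m / (fact m * fact (m + n)) \<le> y ^ m / fact m"
      using assms by (intro divide_left_mono) auto
    then show "norm (bessel_coeff n m * y ^ m) \<le> y ^ m /\<^sub>R fact m"
      using assms by (simp add: bessel_coeff_def abs_mult field_simps)
  qed
  show "summable (\<lambda>m. y ^ m /\<^sub>R fact m)"
    by (rule summable_exp_generic)
qed

lemma bessel_S_pos:
  assumes "y \<ge> 0"
  shows "bessel_S n y > 0"
  unfolding bessel_S_def
proof (rule suminf_pos2[OF summable_bessel_S[OF assms], where i = 0])
  show "0 \<le> bessel_coeff n m * y ^ m" for m
    using assms bessel_coeff_pos[of n m] by simp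
qed (use bessel_coeff_pos[of n 0] in simp)

lemma bessel_I_pos: "x > 0 \<Longrightarrow> bessel_I n x > 0"
  by (simp add: bessel_I_def bessel_S_pos)

text \<open>Multiplying by (m+a)! (m+b)! turns each summand into a product of two binomial
  coefficients, which Vandermonde's identity sums.\<close>

lemma bessel_coeff_convolution:
  "(\<Sum>i\<le>m. bessel_coeff a i * bessel_coeff b (m - i)) =
     real (2 * m + a + b choose m) / (fact (m + a) * fact (m + b))"
proof -
  have "(\<Sum>i\<le>m. bessel_coeff a i * bessel_coeff b (m - i)) =
    (\<Sum>i\<le>m. real ((m + b choose i) * (m + a choose (m - i))) / (fact (m + a) * fact (m + b)))"
  proof (rule sum.cong[OF refl])
    fix i assume "i \<in> {..m}"
    then have i: "i \<le> m" by simp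
    have "real (m + b choose i) = fact (m + b) / (fact i * fact (m - i + b))"
      using i by (subst binomial_fact) auto
    moreover have "real (m + a choose (m - i)) = fact (m + a) / (fact (m - i) * fact (i + a))"
      using i by (subst binomial_fact) (auto simp: add.commute)
    ultimately show "bessel_coeff a i * bessel_coeff b (m - i) =
        real ((m + b choose i) * (m + a choose (m - i))) / (fact (m + a) * fact (m + b))"
      by (simp add: bessel_coeff_def mult_ac add.commute[of i a])
  qed
  also have "\<dots> = real (\<Sum>i\<le>m. (m + b choose i) * (m + a choose (m - i))) / (fact (m + a) * fact (m + b))"
    by (simp add: sum_divide_distrib)
  also have "(\<Sum>i\<le>m. (m + b choose i) * (m + a choose (m - i))) = (m + b + (m + a) choose m)"
    by (rule vandermonde)
  also have "m + b + (m + a) = 2 * m + a + b" by simp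
  finally show ?thesis .
qed

lemma bessel_S_mult_sums:
  assumes "y \<ge> 0"
  shows "(\<lambda>m. real (2 * m + a + b choose m) / (fact (m + a) * fact (m + b)) * y ^ m)
           sums (bessel_S a y * bessel_S b y)"
proof -
  have summ: "summable (\<lambda>m. norm (bessel_coeff n m * y ^ m))" for n
    using summable_bessel_S[OF assms, of n] assms bessel_coeff_pos[of n]
    by (simp add: abs_mult less_imp_le)
  have "(\<lambda>m. \<Sum>i\<le>m. (bessel_coeff a i * y ^ i) * (bessel_coeff b (m - i) * y ^ (m - i)))
      sums (bessel_S a y * bessel_S b y)"
    unfolding bessel_S_def by (rule Cauchy_product_sums[OF summ summ])
  moreover have "(\<Sum>i\<le>m. (bessel_coeff a i * y ^ i) * (bessel_coeff b (m - i) * y ^ (m - i))) =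
      real (2 * m + a + b choose m) / (fact (m + a) * fact (m + b)) * y ^ m" for m
  proof -
    have "(\<Sum>i\<le>m. (bessel_coeff a i * y ^ i) * (bessel_coeff b (m - i) * y ^ (m - i))) =
        (\<Sum>i\<le>m. bessel_coeff a i * bessel_coeff b (m - i) * y ^ m)"
    proof (rule sum.cong[OF refl])
      fix i assume "i \<in> {..m}"
      then have "y ^ m = y ^ i * y ^ (m - i)"
        by (simp flip: power_add)
      then show "(bessel_coeff a i * y ^ i) * (bessel_coeff b (m - i) * y ^ (m - i)) =
          bessel_coeff a i * bessel_coeff b (m - i) * y ^ m"
        by simp
    qed
    then show ?thesis
      by (simp only: sum_distrib_right [symmetric] bessel_coeff_convolution)
  qed
  ultimately show ?thesis by simp
qed

lemma sums_shift_power: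
  fixes y :: real
  assumes "(\<lambda>m. f m * y ^ m) sums s"
  shows "(\<lambda>m. (if m = 0 then 0 else f (m - 1)) * y ^ m) sums (y * s)"
proof -
  have "(\<lambda>m. y * (f m * y ^ m)) sums (y * s)"
    by (rule sums_mult[OF assms])
  then have "(\<lambda>m. (if Suc m = 0 then 0 else f (Suc m - 1)) * y ^ Suc m) sums (y * s)"
    by (simp add: mult_ac)
  then show ?thesis
    by (subst (asm) sums_Suc_iff) simp
qed

text \<open>In the Cauchy products the two squares carry binomials with upper index 2m+2j, the mixed
  product one with 2m+2j+1. Absorption puts all three over the same binomial.\<close>

lemma binomial_pred_eq:
  assumes "m > 0"
  shows "real (2 * m + 2 * j + 1) * real (2 * m + 2 * j choose m)
       = real (m + 2 * j + 1) * real (2 * m + 2 * j + 1 choose m)"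
  and "real (2 * m + 2 * j + 1) * real (2 * m + 2 * j choose (m - 1))
       = real m * real (2 * m + 2 * j + 1 choose m)"
proof -
  show "real (2 * m + 2 * j + 1) * real (2 * m + 2 * j choose (m - 1))
       = real m * real (2 * m + 2 * j + 1 choose m)"
    using binomial_absorption[of "m - 1" "2 * m + 2 * j + 1"] assms
    by (simp del: binomial_Suc_Suc of_nat_mult of_nat_add flip: of_nat_mult) (simp add: algebra_simps)
  have "2 * m + 2 * j + 1 - m = m + 2 * j + 1" "2 * m + 2 * j + 1 - 1 = 2 * m + 2 * j"
    by auto
  then have "(2 * m + 2 * j + 1) * (2 * m + 2 * j choose m) = (m + 2 * j + 1) * (2 * m + 2 * j + 1 choose m)"
    using binomial_absorb_comp[of "2 * m + 2 * j + 1" m] by metis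
  then show "real (2 * m + 2 * j + 1) * real (2 * m + 2 * j choose m)
       = real (m + 2 * j + 1) * real (2 * m + 2 * j + 1 choose m)"
    by (simp only: of_nat_mult [symmetric])
qed

text \<open>
  Both inequalities hold coefficientwise for the Cauchy products; with \<open>B\<close> the binomial coefficient
  \<open>2m+2j+1 choose m\<close> they amount to \<open>(2j+1)(2m+2j+1) \<le> 2(2j+1)(m+j+1)\<close> and
  \<open>2(2j+1)(m+j+1) \<le> (2j+2)(2m+2j+1)\<close>.
\<close>
lemma bessel_S_quadratic:
  assumes "y \<ge> 0"
  shows "2 * y * (bessel_S (Suc j) y)\<^sup>2 + real (2 * j + 1) * (bessel_S (Suc j) y * bessel_S j y)
           \<le> 2 * (bessel_S j y)\<^sup>2"
    and "2 * (bessel_S j y)\<^sup>2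
           \<le> 2 * y * (bessel_S (Suc j) y)\<^sup>2 + real (2 * j + 2) * (bessel_S (Suc j) y * bessel_S j y)"
proof -
  define P where "P = (\<lambda>m. real (2 * m + j + j choose m) / (fact (m + j) * fact (m + j)))"
  define Q where "Q = (\<lambda>m. real (2 * m + Suc j + j choose m) / (fact (m + Suc j) * fact (m + j)))"
  define R0 where "R0 = (\<lambda>m. real (2 * m + Suc j + Suc j choose m) / (fact (m + Suc j) * fact (m + Suc j)))"
  \<comment> \<open>The factor y in front of the square shifts its coefficients by one, so the
    constant coefficient is 0.\<close>
  define R where "R = (\<lambda>m. if m = 0 then 0 else R0 (m - 1))"
  have P: "(\<lambda>m. P m * y ^ m) sums (bessel_S j y)\<^sup>2"
    using bessel_S_mult_sums[OF assms, of j j] by (simp add: P_def power2_eq_square)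
  have Q: "(\<lambda>m. Q m * y ^ m) sums (bessel_S (Suc j) y * bessel_S j y)"
    using bessel_S_mult_sums[OF assms, of "Suc j" j] by (simp only: Q_def)
  have "(\<lambda>m. R0 m * y ^ m) sums (bessel_S (Suc j) y)\<^sup>2"
    using bessel_S_mult_sums[OF assms, of "Suc j" "Suc j"] by (simp only: R0_def power2_eq_square)
  from sums_shift_power[OF this] have R: "(\<lambda>m. R m * y ^ m) sums (y * (bessel_S (Suc j) y)\<^sup>2)"
    by (simp only: R_def)
  have coeff: "2 * R m + real (2 * j + 1) * Q m \<le> 2 * P m \<and>
               2 * P m \<le> 2 * R m + real (2 * j + 2) * Q m" for m
  proof -
    define B where "B = real (2 * m + 2 * j + 1 choose m)"
    define K where "K = (fact (m + j) :: real)"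
    define d where "d = real (2 * m + 2 * j + 1)"
    have K: "K > 0" and d: "d > 0" and B: "B \<ge> 0" by (simp_all add: K_def d_def B_def)
    have Rm: "d * (K * K) * R m = real m * B"
    proof (cases "m = 0")
      case False
      have e: "2 * (m - 1) + Suc j + Suc j = 2 * m + 2 * j" "m - 1 + Suc j = m + j"
        using False by auto
      have "R m = real (2 * m + 2 * j choose (m - 1)) / (K * K)"
        unfolding R_def R0_def e K_def using False by simp
      then show ?thesis
        using K binomial_pred_eq(2)[of m j] False by (simp add: B_def d_def)
    qed (simp add: R_def)
    have Pm: "d * (K * K) * P m = real (m + 2 * j + 1) * B"
    proof (cases "m = 0")
      case True
      then show ?thesis by (simp add: P_def K_def B_def d_def)
    next
      case False
      have e: "2 * m + j + j = 2 * m + 2 * j" by simp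
      have "P m = real (2 * m + 2 * j choose m) / (K * K)"
        unfolding P_def e K_def by simp
      then show ?thesis
        using K binomial_pred_eq(1)[of m j] False by (simp add: B_def d_def)
    qed
    have Qm: "real (m + j + 1) * (K * K) * Q m = B"
    proof -
      have e: "2 * m + Suc j + j = 2 * m + 2 * j + 1" "m + Suc j = Suc (m + j)" by auto
      have "Q m = B / (real (m + j + 1) * K * K)"
        unfolding Q_def e B_def K_def by (simp add: algebra_simps)
      moreover have "real (m + j + 1) \<noteq> 0" by (simp only: of_nat_eq_0_iff)
      ultimately show ?thesis using K by (simp only: mult.assoc) (simp del: of_nat_add)
    qed
    define c where "c = d * (K * K) * real (m + j + 1)"
    have c: "c > 0" using d K by (simp add: c_def)
    have cR: "c * R m = real m * B * real (m + j + 1)"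
      using Rm by (simp add: c_def mult_ac)
    have cP: "c * P m = real (m + 2 * j + 1) * B * real (m + j + 1)"
      using Pm by (simp add: c_def mult_ac)
    have cQ: "c * Q m = d * B"
      using Qm by (simp add: c_def mult_ac)
    \<comment> \<open>After clearing denominators the slack in the two inequalities is exactly
      (2j+1) B and, below, 2m B.\<close>
    have "c * (2 * P m - (2 * R m + real (2 * j + 1) * Q m)) = real (2 * j + 1) * B"
      using cR cP cQ unfolding right_diff_distrib distrib_left mult.left_commute[of c]
      by (simp add: d_def algebra_simps)
    moreover have "real (2 * j + 1) * B \<ge> 0" using B by simp
    ultimately have "2 * P m - (2 * R m + real (2 * j + 1) * Q m) \<ge> 0"
      using c by (metis zero_le_mult_iff not_less)
    moreover have "c * (2 * R m + real (2 * j + 2) * Q m - 2 * P m) = real (2 * m) * B"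
      using cR cP cQ unfolding right_diff_distrib distrib_left mult.left_commute[of c]
      by (simp add: d_def algebra_simps)
    moreover have "real (2 * m) * B \<ge> 0" using B by simp
    ultimately show ?thesis
      using c by (smt (verit) zero_le_mult_iff)
  qed
  have S1: "(\<lambda>m. 2 * (R m * y ^ m) + real (2 * j + 1) * (Q m * y ^ m)) sums
     (2 * (y * (bessel_S (Suc j) y)\<^sup>2) + real (2 * j + 1) * (bessel_S (Suc j) y * bessel_S j y))"
    by (intro sums_add sums_mult P Q R)
  have S2: "(\<lambda>m. 2 * (R m * y ^ m) + real (2 * j + 2) * (Q m * y ^ m)) sums
     (2 * (y * (bessel_S (Suc j) y)\<^sup>2) + real (2 * j + 2) * (bessel_S (Suc j) y * bessel_S j y))"
    by (intro sums_add sums_mult P Q R)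
  have S3: "(\<lambda>m. 2 * (P m * y ^ m)) sums (2 * (bessel_S j y)\<^sup>2)"
    by (intro sums_mult P)
  have "2 * (R m * y ^ m) + real (2 * j + 1) * (Q m * y ^ m) \<le> 2 * (P m * y ^ m)" for m
    using mult_right_mono[OF conjunct1[OF coeff[of m]], of "y ^ m"] assms
    by (simp add: algebra_simps)
  from sums_le[OF this S1 S3]
  show "2 * y * (bessel_S (Suc j) y)\<^sup>2 + real (2 * j + 1) * (bessel_S (Suc j) y * bessel_S j y)
           \<le> 2 * (bessel_S j y)\<^sup>2" by (simp only: mult.assoc)
  have "2 * (P m * y ^ m) \<le> 2 * (R m * y ^ m) + real (2 * j + 2) * (Q m * y ^ m)" for m
    using mult_right_mono[OF conjunct2[OF coeff[of m]], of "y ^ m"] assms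
    by (simp add: algebra_simps)
  from sums_le[OF this S3 S2]
  show "2 * (bessel_S j y)\<^sup>2
           \<le> 2 * y * (bessel_S (Suc j) y)\<^sup>2 + real (2 * j + 2) * (bessel_S (Suc j) y * bessel_S j y)"
    by (simp only: mult.assoc)
qed

section \<open>The function \<open>F\<close> and Amos' bounds\<close>

lemma F_pos: "x > 0 \<Longrightarrow> a \<ge> 0 \<Longrightarrow> F a x > 0"
  by (simp add: F_def add_nonneg_pos sum_power2_gt_zero_iff)

lemma F_eq_sqrt:
  assumes "x > 0" "a \<ge> 0"
  shows "x * F a x = sqrt (a\<^sup>2 + x\<^sup>2) - a"
proof -
  have s: "sqrt (a\<^sup>2 + x\<^sup>2) > 0"
    using assms by (simp add: sum_power2_gt_zero_iff)
  have "(sqrt (a\<^sup>2 + x\<^sup>2) - a) * (a + sqrt (a\<^sup>2 + x\<^sup>2)) = (sqrt (a\<^sup>2 + x\<^sup>2))\<^sup>2 - a\<^sup>2"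
    by (simp add: algebra_simps power2_eq_square)
  also have "\<dots> = x * x"
    by (simp add: power2_eq_square)
  finally show ?thesis
    using assms s unfolding F_def times_divide_eq_right
    by (subst divide_eq_eq) (auto simp: add_nonneg_pos)
qed

text \<open>Completing the square: x times the quadratic in r is (x r + a)^2 - (a^2 + x^2), and x
  \<open>F a x\<close> + a is the square root of a^2 + x^2. A comparison with \<open>F\<close> thus
  loses its square root.\<close>

lemma F_le_iff:
  assumes "x > 0" "a \<ge> 0" "r \<ge> 0"
  shows "r \<le> F a x \<longleftrightarrow> x * r\<^sup>2 + 2 * a * r \<le> x"
    and "F a x \<le> r \<longleftrightarrow> x \<le> x * r\<^sup>2 + 2 * a * r"
proof -
  have e: "x * (x * r\<^sup>2 + 2 * a * r - x) = (x * r + a)\<^sup>2 - (a\<^sup>2 + x\<^sup>2)"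
    by (simp add: algebra_simps power2_eq_square)
  have "r \<le> F a x \<longleftrightarrow> x * r \<le> x * F a x" using assms by simp
  also have "\<dots> \<longleftrightarrow> x * r + a \<le> sqrt (a\<^sup>2 + x\<^sup>2)" using F_eq_sqrt[OF assms(1,2)] by auto
  also have "\<dots> \<longleftrightarrow> (x * r + a)\<^sup>2 \<le> a\<^sup>2 + x\<^sup>2"
    using assms by (metis real_le_rsqrt real_sqrt_le_iff real_sqrt_abs abs_of_nonneg add_nonneg_nonneg mult_nonneg_nonneg less_imp_le)
  also have "\<dots> \<longleftrightarrow> x * (x * r\<^sup>2 + 2 * a * r - x) \<le> 0" unfolding e by simp
  also have "\<dots> \<longleftrightarrow> x * r\<^sup>2 + 2 * a * r \<le> x" using assms by (simp add: mult_le_0_iff)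
  finally show "r \<le> F a x \<longleftrightarrow> x * r\<^sup>2 + 2 * a * r \<le> x" .
  have "F a x \<le> r \<longleftrightarrow> x * F a x \<le> x * r" using assms by simp
  also have "\<dots> \<longleftrightarrow> sqrt (a\<^sup>2 + x\<^sup>2) \<le> x * r + a" using F_eq_sqrt[OF assms(1,2)] by auto
  also have "\<dots> \<longleftrightarrow> a\<^sup>2 + x\<^sup>2 \<le> (x * r + a)\<^sup>2"
    using assms by (metis real_sqrt_le_iff real_sqrt_abs abs_of_nonneg add_nonneg_nonneg mult_nonneg_nonneg less_imp_le)
  also have "\<dots> \<longleftrightarrow> 0 \<le> x * (x * r\<^sup>2 + 2 * a * r - x)" unfolding e by simp
  also have "\<dots> \<longleftrightarrow> x \<le> x * r\<^sup>2 + 2 * a * r" using assms by (simp add: zero_le_mult_iff)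
  finally show "F a x \<le> r \<longleftrightarrow> x \<le> x * r\<^sup>2 + 2 * a * r" .
qed

lemma bessel_I_ratio_bounds:
  assumes "x > 0"
  shows "F (real j + 1) x \<le> bessel_I (Suc j) x / bessel_I j x"
    and "bessel_I (Suc j) x / bessel_I j x \<le> F (real j + 1 / 2) x"
proof -
  define y where "y = (x / 2)\<^sup>2"
  define S0 where "S0 = bessel_S j y"
  define S1 where "S1 = bessel_S (Suc j) y"
  have y: "y \<ge> 0" by (simp add: y_def)
  have S: "S0 > 0" "S1 > 0" by (simp_all add: S0_def S1_def bessel_S_pos y)
  define r where "r = x / 2 * S1 / S0"
  have r: "bessel_I (Suc j) x / bessel_I j x = r"
    using assms S by (simp add: bessel_I_def r_def S0_def S1_def y_def)
  have r0: "r \<ge> 0" using assms S by (simp add: r_def)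
  \<comment> \<open>Up to a positive factor, the quadratic at r is the expression of
    \<open>bessel_S_quadratic\<close>; its two parts are the choices 2a = 2j + 1 and 2a = 2j +
    2.\<close>
  have q: "x * r\<^sup>2 + 2 * a * r - x = (x / 2) * (2 * y * S1\<^sup>2 + 2 * a * (S1 * S0) - 2 * S0\<^sup>2) / S0\<^sup>2" for a
    using S by (simp add: r_def y_def field_simps power2_eq_square)
  have "2 * y * S1\<^sup>2 + 2 * (real j + 1 / 2) * (S1 * S0) - 2 * S0\<^sup>2 \<le> 0"
    using bessel_S_quadratic(1)[OF y, of j] by (simp add: S0_def S1_def algebra_simps)
  then have "x * r\<^sup>2 + 2 * (real j + 1 / 2) * r - x \<le> 0"
    unfolding q using assms by (intro divide_nonpos_nonneg mult_nonneg_nonpos) auto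
  then show "bessel_I (Suc j) x / bessel_I j x \<le> F (real j + 1 / 2) x"
    unfolding r using F_le_iff(1)[OF assms _ r0, of "real j + 1 / 2"] by simp
  have "2 * y * S1\<^sup>2 + 2 * (real j + 1) * (S1 * S0) - 2 * S0\<^sup>2 \<ge> 0"
    using bessel_S_quadratic(2)[OF y, of j] by (simp add: S0_def S1_def algebra_simps)
  then have "x * r\<^sup>2 + 2 * (real j + 1) * r - x \<ge> 0"
    unfolding q using assms by (intro divide_nonneg_nonneg mult_nonneg_nonneg) auto
  then show "F (real j + 1) x \<le> bessel_I (Suc j) x / bessel_I j x"
    unfolding r using F_le_iff(2)[OF assms _ r0, of "real j + 1"] by simp
qed

section \<open>The Skellam law\<close>

lemma pmf_skellam:
  assumes "lam1 > 0" "lam2 > 0"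
  shows "pmf (skellam_pmf lam1 lam2) (int n) =
           exp (- (lam1 + lam2)) * lam1 ^ n * bessel_S n (lam1 * lam2)"
proof -
  define D where "D = pair_pmf (poisson_pmf lam1) (poisson_pmf lam2)"
  define A where "A = (\<lambda>m. {(m + n, m)})"
  have pre: "(\<lambda>(a, b). int a - int b) -` {int n} = (\<Union>m. A m)"
    by (auto simp: A_def)
  have "(\<lambda>m. measure (measure_pmf D) (A m)) sums measure (measure_pmf D) (\<Union>m. A m)"
    by (rule measure_pmf.finite_measure_UNION) (auto simp: A_def disjoint_family_on_def)
  moreover have "measure (measure_pmf D) (A m) =
      (exp (- (lam1 + lam2)) * lam1 ^ n) * (bessel_coeff n m * (lam1 * lam2) ^ m)" for m
    using assms
    by (simp add: A_def measure_pmf_single D_def pmf_pair bessel_coeff_def power_add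
        power_mult_distrib exp_add exp_minus field_simps exp_diff)
  ultimately have "(\<lambda>m. (exp (- (lam1 + lam2)) * lam1 ^ n) * (bessel_coeff n m * (lam1 * lam2) ^ m))
      sums measure (measure_pmf D) (\<Union>m. A m)" by simp
  moreover have "(\<lambda>m. (exp (- (lam1 + lam2)) * lam1 ^ n) * (bessel_coeff n m * (lam1 * lam2) ^ m))
      sums ((exp (- (lam1 + lam2)) * lam1 ^ n) * bessel_S n (lam1 * lam2))"
    unfolding bessel_S_def
    by (intro sums_mult summable_sums summable_bessel_S) (use assms in simp)
  ultimately have "measure (measure_pmf D) (\<Union>m. A m) =
      (exp (- (lam1 + lam2)) * lam1 ^ n) * bessel_S n (lam1 * lam2)"
    by (rule sums_unique2)
  then show ?thesis
    by (simp only: skellam_pmf_def pmf_map pre D_def [symmetric])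
qed

text \<open>Supplies the negative values, which \<open>pmf_skellam\<close> leaves out: exchanging
  the two identically distributed variables negates their difference.\<close>

lemma pmf_skellam_sym: "pmf (skellam_pmf t t) (- k) = pmf (skellam_pmf t t) k"
proof -
  have "skellam_pmf t t = map_pmf uminus (skellam_pmf t t)"
    unfolding skellam_pmf_def
    by (subst pair_commute_pmf) (simp add: pmf.map_comp o_def case_prod_unfold)
  then have "pmf (skellam_pmf t t) (- k) = pmf (map_pmf uminus (skellam_pmf t t)) (- k)"
    by simp
  also have "\<dots> = pmf (skellam_pmf t t) k"
    by (rule pmf_map_inj') simp
  finally show ?thesis .
qed

text \<open>
  The generating function identity \<open>e\<^sup>x = I\<^sub>0(x) + 2 \<Sum> I\<^sub>n(x)\<close> expresses that the symmetric
  Skellam law with rates \<open>x/2\<close> has total mass one.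
\<close>
lemma bessel_I_ratio_sums:
  assumes "x > 0"
  shows "(\<lambda>n. bessel_I (Suc n) x / bessel_I 0 x) sums ((exp x / bessel_I 0 x - 1) / 2)"
proof -
  define p where "p = skellam_pmf (x / 2) (x / 2)"
  have p: "pmf p (int n) = exp (- x) * bessel_I n x" for n
    using pmf_skellam[of "x / 2" "x / 2" n] assms
    by (simp add: p_def bessel_I_def power2_eq_square)
  have p': "pmf p (- int n) = exp (- x) * bessel_I n x" for n
    using p[of n] pmf_skellam_sym[of "x / 2" "int n"] by (simp add: p_def)
  \<comment> \<open>\<open>A 0\<close> is a singleton, whereas every other \<open>A n\<close> has
    two elements; hence I_0 enters once and I_n twice.\<close>
  define A where "A = (\<lambda>n. {int n, - int n})"
  have "(\<lambda>n. measure (measure_pmf p) (A n)) sums measure (measure_pmf p) (\<Union>n. A n)"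
    by (rule measure_pmf.finite_measure_UNION) (auto simp: A_def disjoint_family_on_def)
  moreover have "(\<Union>n. A n) = UNIV"
  proof (intro set_eqI iffI UNIV_I)
    fix k :: int
    have "k \<in> A (nat \<bar>k\<bar>)" by (auto simp: A_def)
    then show "k \<in> (\<Union>n. A n)" by blast
  qed
  ultimately have "(\<lambda>n. measure (measure_pmf p) (A n)) sums 1"
    by simp
  then have "(\<lambda>n. measure (measure_pmf p) (A (Suc n))) sums (1 - measure (measure_pmf p) (A 0))"
    by (subst sums_Suc_iff) simp
  moreover have "measure (measure_pmf p) (A 0) = exp (- x) * bessel_I 0 x"
    using p[of 0] by (simp add: A_def measure_pmf_single)
  moreover have "measure (measure_pmf p) (A (Suc n)) = 2 * (exp (- x) * bessel_I (Suc n) x)" for n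
    using p[of "Suc n"] p'[of "Suc n"]
    by (subst measure_measure_pmf_finite) (auto simp: A_def)
  ultimately have "(\<lambda>n. 2 * (exp (- x) * bessel_I (Suc n) x)) sums (1 - exp (- x) * bessel_I 0 x)"
    by simp
  from sums_mult[OF this, of "exp x / (2 * bessel_I 0 x)"]
  have "(\<lambda>n. exp x / (2 * bessel_I 0 x) * (2 * (exp (- x) * bessel_I (Suc n) x)))
      sums (exp x / (2 * bessel_I 0 x) * (1 - exp (- x) * bessel_I 0 x))" .
  moreover have "exp x / (2 * bessel_I 0 x) * (2 * (exp (- x) * bessel_I (Suc n) x)) =
      bessel_I (Suc n) x / bessel_I 0 x" for n
    by (simp add: exp_minus)
  moreover have "exp x / (2 * bessel_I 0 x) * (1 - exp (- x) * bessel_I 0 x) =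
      (exp x / bessel_I 0 x - 1) / 2"
    using bessel_I_pos[OF assms, of 0] by (simp add: exp_minus field_simps)
  ultimately show ?thesis by (simp only:)
qed

section \<open>Exponential and Gaussian bounds\<close>

lemma F_eq_exp_arsinh:
  assumes "x > 0"
  shows "F a x = exp (- arsinh (a / x))"
proof -
  have "exp (arsinh (a / x)) = a / x + sqrt ((a / x)\<^sup>2 + 1)"
    by (simp add: arsinh_real_def arsinh_real_aux)
  also have "(a / x)\<^sup>2 + 1 = (a\<^sup>2 + x\<^sup>2) / x\<^sup>2"
    using assms by (simp add: field_simps)
  also have "sqrt \<dots> = sqrt (a\<^sup>2 + x\<^sup>2) / x"
    using assms by (simp add: real_sqrt_divide)
  finally have "a + sqrt (a\<^sup>2 + x\<^sup>2) = x * exp (arsinh (a / x))"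
    using assms by (simp add: field_simps)
  then show ?thesis
    using assms by (simp add: F_def exp_minus field_simps)
qed

lemma F_antimono:
  assumes "x > 0" "a \<le> b"
  shows "F b x \<le> F a x"
proof -
  have "a / x \<le> b / x" using assms by (simp add: divide_right_mono)
  then show ?thesis
    unfolding F_eq_exp_arsinh[OF assms(1)]
    by (metis exp_le_cancel_iff neg_le_iff_le arsinh_less_iff_real not_less)
qed

lemma F_less_1:
  assumes "x > 0" "a > 0"
  shows "F a x < 1"
  using assms by (simp add: F_eq_exp_arsinh)

lemma convex_on_sinh: "convex_on {0..} (sinh :: real \<Rightarrow> real)"
  by (rule f''_ge0_imp_convex[where f' = cosh and f'' = sinh]) (auto intro!: derivative_eq_intros)

text \<open>The origin of the constant: 1 / (sqrt 2 - 1) = 1 + sqrt 2, whose logarithm is arsinh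
  1.\<close>

lemma sinh_alpha0: "sinh alpha0 = 1"
proof -
  have "(sqrt 2 - 1) * (1 + sqrt 2) = 1"
    by (simp add: algebra_simps)
  moreover have "1 < sqrt (2::real)" by simp
  ultimately have "1 + sqrt 2 = 1 / (sqrt 2 - 1)"
    by (simp add: field_simps)
  then have "alpha0 = arsinh 1"
    using \<open>1 < sqrt 2\<close> by (simp add: alpha0_def arsinh_real_def ln_div)
  then show ?thesis by (metis sinh_arsinh_real)
qed

lemma alpha0_pos: "alpha0 > 0"
  using sinh_alpha0 by (metis sinh_real_pos_iff zero_less_one)

lemma arsinh_le_self:
  assumes "s \<ge> (0::real)"
  shows "arsinh s \<le> s"
proof -
  have "((\<lambda>u. u - arsinh u) has_real_derivative (1 - 1 / sqrt (u\<^sup>2 + 1))) (at u)" for u :: real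
    by (auto intro!: derivative_eq_intros)
  moreover have "1 - 1 / sqrt (u\<^sup>2 + 1) \<ge> 0" for u :: real
    using frac_le[of 1 1 1 "sqrt (u\<^sup>2 + 1)"] by simp
  ultimately have "0 - arsinh 0 \<le> s - arsinh s"
    by (intro DERIV_nonneg_imp_nondecreasing[OF assms]) blast
  then show ?thesis by simp
qed

text \<open>On [0, \<open>alpha0\<close>] the convex function sinh lies below its chord from (0,0)
  to (\<open>alpha0\<close>,1), so sinh (\<open>alpha0\<close> s) \<le> s; then sinh is
  inverted.\<close>

lemma alpha0_mult_le_arsinh:
  assumes "0 \<le> s" "s \<le> 1"
  shows "alpha0 * s \<le> arsinh s"
proof -
  have "sinh ((1 - s) *\<^sub>R 0 + s *\<^sub>R alpha0) \<le> (1 - s) * sinh 0 + s * sinh alpha0"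
    using assms alpha0_pos by (intro convex_onD[OF convex_on_sinh]) auto
  then have "sinh (alpha0 * s) \<le> sinh (arsinh s)"
    by (simp add: sinh_alpha0 mult.commute)
  then show ?thesis by (simp only: sinh_real_le_iff)
qed

lemma exp_le_F:
  assumes "x > 0" "a \<ge> 0"
  shows "exp (- (a / x)) \<le> F a x"
  using assms arsinh_le_self[of "a / x"] by (simp add: F_eq_exp_arsinh)

lemma F_le_exp_alpha0:
  assumes "x > 0" "0 \<le> a" "a \<le> x"
  shows "F a x \<le> exp (- (alpha0 * a / x))"
  using assms alpha0_mult_le_arsinh[of "a / x"] by (simp add: F_eq_exp_arsinh)

section \<open>The Gaussian integral and its tail\<close>

definition gauss_int :: "real \<Rightarrow> real" where
  "gauss_int s = integral {0..s} (\<lambda>u. exp (- u\<^sup>2))"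

lemma gauss_int_has_derivative:
  assumes "s > 0"
  shows "(gauss_int has_real_derivative exp (- s\<^sup>2)) (at s)"
proof -
  have "((\<lambda>s. integral {0..s} (\<lambda>u. exp (- u\<^sup>2))) has_real_derivative exp (- s\<^sup>2)) (at s within {0..s + 1})"
    using assms by (intro integral_has_real_derivative continuous_intros) auto
  moreover have "at s within {0..s + 1} = at s"
    using assms by (intro at_within_interior) (simp add: interior_atLeastAtMost_real)
  ultimately show ?thesis
    by (simp add: gauss_int_def [abs_def])
qed

lemma continuous_on_gauss_int: "continuous_on {0..a} gauss_int"
  unfolding gauss_int_def [abs_def]
  by (intro indefinite_integral_continuous_1 integrable_continuous_interval continuous_intros)

lemma gauss_int_le: "gauss_int s \<le> sqrt pi / 2"
proof -
  define f where "f = (\<lambda>u :: real. indicator {0..} u *\<^sub>R exp (- u\<^sup>2))"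
  have f: "(f has_integral (sqrt pi / 2)) UNIV"
    using has_integral_integral_lborel[of f] gaussian_moment_0[folded f_def]
    by (metis has_bochner_integral_iff)
  have "integral {0..s} (\<lambda>u. exp (- u\<^sup>2)) = integral {0..s} f"
    by (intro integral_cong) (simp add: f_def)
  also have "\<dots> \<le> integral UNIV f"
  proof (rule integral_subset_le)
    show "f integrable_on UNIV" using f by blast
    have "(\<lambda>u. exp (- u\<^sup>2)) integrable_on {0..s}"
      by (intro integrable_continuous_interval continuous_intros)
    then show "f integrable_on {0..s}"
      by (rule integrable_eq) (simp add: f_def)
  qed (auto simp: f_def)
  also have "\<dots> = sqrt pi / 2" using f by blast
  finally show ?thesis by (simp add: gauss_int_def)
qed

text \<open>The classical Mills-type lower bound for the integral of exp (- u^2) from s to infinity.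
  For s \<ge> 0, \<open>gauss_int s\<close> is sqrt pi / 2 times the error function.\<close>

definition mills :: "real \<Rightarrow> real" where
  "mills s = exp (- s\<^sup>2) / (s + sqrt (s\<^sup>2 + 2))"

text \<open>The left side is nondecreasing in s: with w = sqrt (u^2 + 2), its derivative at u is exp
  (- u^2) (1 - u/w) / (u + w)^2. As s grows, \<open>mills s\<close> vanishes and
  \<open>gauss_int s\<close> stays below sqrt pi / 2.\<close>

lemma gauss_int_plus_mills_le:
  assumes "s > 0"
  shows "gauss_int s + mills s \<le> sqrt pi / 2"
proof -
  have mono: "gauss_int s + mills s \<le> gauss_int v + mills v" if sv: "s \<le> v" for v
  proof (rule DERIV_nonneg_imp_nondecreasing[OF sv])
    fix u assume u: "s \<le> u" "u \<le> v"
    then have u0: "u > 0" using assms by simp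
    define w where "w = sqrt (u\<^sup>2 + 2)"
    have w: "w > 0" "w\<^sup>2 = u\<^sup>2 + 2" by (simp_all add: w_def add_nonneg_pos)
    define E where "E = exp (- u\<^sup>2)"
    define D where "D = (- (2 * u * E) * (u + w) - E * (1 + u / w)) / (u + w)\<^sup>2"
    have p: "u * u + 2 > 0" "u + sqrt (u * u + 2) > 0"
      using u0 by (simp_all add: add_pos_pos)
    have "(mills has_real_derivative D) (at u)"
      unfolding mills_def [abs_def] D_def E_def w_def
      using u0 p
      by (auto intro!: derivative_eq_intros simp: field_simps power2_eq_square)
    then have "((\<lambda>v. gauss_int v + mills v) has_real_derivative (E + D)) (at u)"
      unfolding E_def by (intro DERIV_add gauss_int_has_derivative u0)
    moreover have "E + D \<ge> 0"
    proof -
      have "E + D = E * ((u + w)\<^sup>2 - 2 * u * (u + w) - (1 + u / w)) / (u + w)\<^sup>2"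
        using u0 w by (simp add: D_def field_simps)
      also have "(u + w)\<^sup>2 - 2 * u * (u + w) - (1 + u / w) = (w\<^sup>2 - u\<^sup>2) - (1 + u / w)"
        by (simp add: power2_eq_square algebra_simps)
      also have "\<dots> = 1 - u / w" using w by simp
      also have "E * (1 - u / w) / (u + w)\<^sup>2 \<ge> 0"
      proof -
        have "u\<^sup>2 \<le> w\<^sup>2" using w by simp
        then have "u \<le> w" using w(1) by (metis power2_le_imp_le less_imp_le)
        then show ?thesis using w by (simp add: E_def)
      qed
      finally show ?thesis .
    qed
    ultimately show "\<exists>y. ((\<lambda>v. gauss_int v + mills v) has_real_derivative y) (at u) \<and> 0 \<le> y"
      by blast
  qed
  have "gauss_int s + mills s \<le> sqrt pi / 2 + e" if e: "e > 0" for e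
  proof -
    define v where "v = max s (1 / e)"
    have v: "v \<ge> s" "v > 0" "1 / e \<le> v" using assms by (auto simp: v_def)
    have "mills v \<le> 1 / v"
      unfolding mills_def using v by (intro frac_le) auto
    also have "\<dots> \<le> e" using v e by (simp add: field_simps)
    finally show ?thesis using mono[OF v(1)] gauss_int_le[of v] by linarith
  qed
  then show ?thesis by (rule field_le_epsilon)
qed

text \<open>A right-endpoint Riemann sum of mesh b for a decreasing function. The mean value theorem
  handles one cell at a time; it asks for derivatives only inside the cell, so the cell starting at
  0 needs no special treatment.\<close>

lemma sum_exp_le_gauss_int:
  assumes "b > 0"
  shows "b * (\<Sum>k=1..m. exp (- (b * real k)\<^sup>2)) \<le> gauss_int (b * real m)"
proof (induction m)
  case 0
  show ?case by (simp add: gauss_int_def)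
next
  case (Suc m)
  define u where "u = b * real m"
  define v where "v = b * real (Suc m)"
  have uv: "0 \<le> u" "u < v" using assms by (simp_all add: u_def v_def)
  have "\<exists>l z. u < z \<and> z < v \<and> (gauss_int has_real_derivative l) (at z) \<and>
           gauss_int v - gauss_int u = (v - u) * l"
  proof (rule MVT[OF uv(2)])
    show "continuous_on {u..v} gauss_int"
      by (rule continuous_on_subset[OF continuous_on_gauss_int[of v]]) (use uv in auto)
    show "gauss_int differentiable (at z)" if "u < z" "z < v" for z
      using gauss_int_has_derivative[of z] that uv by (auto simp: real_differentiable_def)
  qed
  then obtain l z where z: "u < z" "z < v" "(gauss_int has_real_derivative l) (at z)"
    "gauss_int v - gauss_int u = (v - u) * l" by blast
  have "l = exp (- z\<^sup>2)"
    using DERIV_unique[OF z(3) gauss_int_has_derivative] z uv by simp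
  moreover have "exp (- v\<^sup>2) \<le> exp (- z\<^sup>2)"
    using z uv by (simp add: power_mono)
  moreover have "v - u = b" by (simp add: u_def v_def algebra_simps)
  ultimately have "b * exp (- v\<^sup>2) \<le> gauss_int v - gauss_int u"
    using z(4) assms by simp
  then show ?case
    using Suc by (simp add: u_def v_def distrib_left)
qed

lemma gauss_int_mono: "0 \<le> u \<Longrightarrow> u \<le> v \<Longrightarrow> gauss_int u \<le> gauss_int v"
  unfolding gauss_int_def
  by (intro integral_subset_le integrable_continuous_interval continuous_intros) auto

section \<open>Products and sums of Bessel ratios\<close>

definition bessel_ratio :: "nat \<Rightarrow> real \<Rightarrow> real" where
  "bessel_ratio n x = bessel_I n x / bessel_I 0 x"

definition bessel_ratio_sum :: "real \<Rightarrow> real" where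
  "bessel_ratio_sum x = (\<Sum>n. bessel_ratio (Suc n) x)"

lemma bessel_ratio_0: "x > 0 \<Longrightarrow> bessel_ratio 0 x = 1"
  using bessel_I_pos[of x 0] by (simp add: bessel_ratio_def)

lemma bessel_ratio_pos: "x > 0 \<Longrightarrow> bessel_ratio n x > 0"
  by (simp add: bessel_ratio_def bessel_I_pos)

lemma bessel_ratio_Suc_bounds:
  assumes "x > 0"
  shows "bessel_ratio n x * F (real n + 1) x \<le> bessel_ratio (Suc n) x"
    and "bessel_ratio (Suc n) x \<le> bessel_ratio n x * F (real n + 1 / 2) x"
proof -
  have e: "bessel_ratio (Suc n) x = bessel_ratio n x * (bessel_I (Suc n) x / bessel_I n x)"
    using bessel_I_pos[OF assms, of n] by (simp add: bessel_ratio_def)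
  show "bessel_ratio n x * F (real n + 1) x \<le> bessel_ratio (Suc n) x"
    and "bessel_ratio (Suc n) x \<le> bessel_ratio n x * F (real n + 1 / 2) x"
    unfolding e using bessel_ratio_pos[OF assms, of n] bessel_I_ratio_bounds[OF assms, of n]
    by (intro mult_left_mono; simp)+
qed

lemma bessel_ratio_sums:
  assumes "x > 0"
  shows "(\<lambda>n. bessel_ratio (Suc n) x) sums bessel_ratio_sum x"
    and "1 + 2 * bessel_ratio_sum x = exp x / bessel_I 0 x"
  using bessel_I_ratio_sums[OF assms]
  by (auto simp: bessel_ratio_def bessel_ratio_sum_def sums_iff)

text \<open>The first m terms are kept, the next two are bounded below by Amos, and the positive
  remainder is dropped. \<open>L0\<close> uses m = 0 when [x] < 2 and m = [x] - 1 otherwise.\<close>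

lemma bessel_ratio_sum_lower:
  assumes "x > 0"
  shows "(\<Sum>k=1..m. bessel_ratio k x)
           + bessel_ratio m x * (F (real m + 1) x * (1 + F (real m + 2) x)) \<le> bessel_ratio_sum x"
proof -
  have "bessel_ratio m x * F (real m + 1) x * F (real m + 2) x
      \<le> bessel_ratio (Suc m) x * F (real m + 2) x"
    using bessel_ratio_Suc_bounds(1)[OF assms, of m] F_pos[OF assms, of "real m + 2"]
    by (simp add: mult_right_mono)
  also have "\<dots> \<le> bessel_ratio (Suc (Suc m)) x"
    using bessel_ratio_Suc_bounds(1)[OF assms, of "Suc m"] by (simp add: add_ac)
  finally have "(\<Sum>k=1..m. bessel_ratio k x)
      + bessel_ratio m x * (F (real m + 1) x * (1 + F (real m + 2) x))
      \<le> (\<Sum>k=1..m. bessel_ratio k x) + (bessel_ratio (Suc m) x + bessel_ratio (Suc (Suc m)) x)"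
    using bessel_ratio_Suc_bounds(1)[OF assms, of m] by (simp add: algebra_simps)
  also have "\<dots> = (\<Sum>k<m + 2. bessel_ratio (Suc k) x)"
    by (simp add: sum.atLeast1_atMost_eq)
  also have "\<dots> \<le> bessel_ratio_sum x"
    unfolding bessel_ratio_sum_def
    using bessel_ratio_sums(1)[OF assms] bessel_ratio_pos[OF assms]
    by (intro sum_le_suminf) (auto simp: sums_iff less_imp_le)
  finally show ?thesis .
qed

text \<open>\<open>F\<close> decreases in its first argument, so after term m + 1 all successive
  quotients are at most q = F(m + 3/2, x). The geometric series with ratio q gives the denominator 1
  - q.\<close>

lemma bessel_ratio_sum_upper:
  assumes "x > 0"
  shows "bessel_ratio_sum x \<le> (\<Sum>k=1..m. bessel_ratio k x)
           + bessel_ratio m x * (F (real m + 1 / 2) x / (1 - F (real m + 3 / 2) x))"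
proof -
  define q where "q = F (real m + 3 / 2) x"
  define c where "c = bessel_ratio m x * F (real m + 1 / 2) x"
  have q: "0 < q" "q < 1" using F_pos[OF assms] F_less_1[OF assms] by (simp_all add: q_def)
  have le: "bessel_ratio (Suc (j + m)) x \<le> c * q ^ j" for j
  proof (induction j)
    case 0
    show ?case using bessel_ratio_Suc_bounds(2)[OF assms, of m] by (simp add: c_def)
  next
    case (Suc j)
    have "bessel_ratio (Suc (Suc j + m)) x
        \<le> bessel_ratio (Suc (j + m)) x * F (real (Suc (j + m)) + 1 / 2) x"
      using bessel_ratio_Suc_bounds(2)[OF assms, of "Suc (j + m)"] by simp
    also have "\<dots> \<le> bessel_ratio (Suc (j + m)) x * q"
      unfolding q_def using bessel_ratio_pos[OF assms, of "Suc (j + m)"]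
      by (intro mult_left_mono F_antimono assms) auto
    also have "\<dots> \<le> c * q ^ j * q"
      using Suc q by (intro mult_right_mono) auto
    finally show ?case by (simp add: mult_ac)
  qed
  have s1: "(\<lambda>j. bessel_ratio (Suc (j + m)) x)
      sums (bessel_ratio_sum x - (\<Sum>k<m. bessel_ratio (Suc k) x))"
    using bessel_ratio_sums(1)[OF assms] sums_iff_shift'[of "\<lambda>k. bessel_ratio (Suc k) x" m] by blast
  have s2: "(\<lambda>j. c * q ^ j) sums (c * (1 / (1 - q)))"
    using q by (intro sums_mult geometric_sums) auto
  have "bessel_ratio_sum x - (\<Sum>k<m. bessel_ratio (Suc k) x) \<le> c * (1 / (1 - q))"
    by (rule sums_le[OF le s1 s2])
  moreover have "(\<Sum>k<m. bessel_ratio (Suc k) x) = (\<Sum>k=1..m. bessel_ratio k x)"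
    by (simp add: sum.atLeast1_atMost_eq)
  ultimately show ?thesis by (simp add: c_def q_def algebra_simps)
qed

text \<open>The k-th factor F(k,x) is at least exp (- k/x), and 1 + ... + n = n(n+1)/2.\<close>

lemma exp_le_bessel_ratio:
  assumes "x > 0"
  shows "exp (- (real n * (real n + 1) / (2 * x))) \<le> bessel_ratio n x"
proof (induction n)
  case 0
  show ?case using assms by (simp add: bessel_ratio_0)
next
  case (Suc n)
  have "exp (- (real (Suc n) * (real (Suc n) + 1) / (2 * x)))
      = exp (- (real n * (real n + 1) / (2 * x))) * exp (- ((real n + 1) / x))"
    using assms by (simp add: field_simps flip: exp_add)
  also have "\<dots> \<le> bessel_ratio n x * F (real n + 1) x"
    using assms Suc by (intro mult_mono exp_le_F) (auto intro: less_imp_le bessel_ratio_pos)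
  also have "\<dots> \<le> bessel_ratio (Suc n) x"
    by (rule bessel_ratio_Suc_bounds[OF assms])
  finally show ?case .
qed

text \<open>Now the factors are F(k + 1/2, x) for k < n, and these half-integers sum to n^2/2. The
  condition n \<le> x keeps each k + 1/2 where the chord bound for arsinh holds.\<close>

lemma bessel_ratio_le_exp:
  assumes "x > 0" "real n \<le> x"
  shows "bessel_ratio n x \<le> exp (- (alpha0 / (2 * x)) * (real n)\<^sup>2)"
  using assms(2)
proof (induction n)
  case 0
  show ?case using assms by (simp add: bessel_ratio_0)
next
  case (Suc n)
  have "bessel_ratio (Suc n) x \<le> bessel_ratio n x * F (real n + 1 / 2) x"
    by (rule bessel_ratio_Suc_bounds[OF assms(1)])
  also have "\<dots> \<le> exp (- (alpha0 / (2 * x)) * (real n)\<^sup>2) * exp (- (alpha0 * (real n + 1 / 2) / x))"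
    using assms Suc F_pos[OF assms(1), of "real n + 1 / 2"]
    by (intro mult_mono F_le_exp_alpha0) auto
  also have "\<dots> = exp (- (alpha0 / (2 * x)) * (real (Suc n))\<^sup>2)"
    using assms(1) by (simp add: field_simps power2_eq_square flip: exp_add)
  finally show ?case .
qed

text \<open>Turns the Beta factors of the theorem into reciprocals of rising factorials, the form in
  which the products of rational bounds on \<open>F\<close> appear.\<close>

lemma Beta_of_nat:
  fixes c :: real
  assumes "c > 0" "j > 0"
  shows "Beta c (real j) / fact (j - 1) = 1 / pochhammer c j"
proof -
  have "c \<notin> \<int>\<^sub>\<le>\<^sub>0" using assms by (auto elim!: nonpos_Ints_cases)
  moreover have "Gamma (real j) = fact (j - 1)"
    using assms Gamma_fact[of "j - 1", where ?'a = real] by (simp add: of_nat_diff)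
  ultimately show ?thesis
    by (simp add: pochhammer_Gamma Beta_def)
qed

text \<open>From sqrt (a^2 + x^2) \<le> a + x one gets F(a,x) \<ge> (x/2) / (a + x/2). As a runs
  through consecutive values, the denominators multiply to a rising factorial.\<close>

lemma bessel_ratio_tail_lower:
  assumes "x > 0"
  shows "bessel_ratio n x * ((x / 2) ^ j / pochhammer (real n + x / 2 + 1) j) \<le> bessel_ratio (n + j) x"
proof (induction j)
  case (Suc j)
  define a where "a = real (n + j) + 1"
  have a: "a > 0" by (simp add: a_def)
  have "sqrt (a\<^sup>2 + x\<^sup>2) \<le> a + x"
    using sqrt_sum_squares_le_sum[of a x] a assms by simp
  then have "x / (a + (a + x)) \<le> F a x"
    using a assms unfolding F_def
    by (intro divide_left_mono) (auto intro!: mult_pos_pos add_pos_nonneg)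
  moreover have "(x / 2) / (a + x / 2) = x / (a + (a + x))"
    using a assms by (simp add: field_simps)
  ultimately have F: "(x / 2) / (a + x / 2) \<le> F a x" by simp
  then have "(bessel_ratio n x * ((x / 2) ^ j / pochhammer (real n + x / 2 + 1) j)) * ((x / 2) / (a + x / 2))
      \<le> bessel_ratio (n + j) x * F a x"
    using Suc F assms a by (intro mult_mono) (auto intro: less_imp_le bessel_ratio_pos)
  also have "\<dots> \<le> bessel_ratio (n + Suc j) x"
    unfolding a_def using bessel_ratio_Suc_bounds(1)[OF assms, of "n + j"] by simp
  finally have "bessel_ratio n x * ((x / 2) ^ j / pochhammer (real n + x / 2 + 1) j) * ((x / 2) / (a + x / 2))
      \<le> bessel_ratio (n + Suc j) x" .
  moreover have P: "pochhammer (real n + x / 2 + 1) (Suc j) = pochhammer (real n + x / 2 + 1) j * (a + x / 2)"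
    by (simp add: pochhammer_Suc a_def algebra_simps)
  have "(x / 2) ^ Suc j / pochhammer (real n + x / 2 + 1) (Suc j)
      = (x / 2) ^ j / pochhammer (real n + x / 2 + 1) j * ((x / 2) / (a + x / 2))"
    by (simp only: P power_Suc2 times_divide_times_eq)
  ultimately show ?case by (simp only: mult.assoc)
qed simp

text \<open>The counterpart with sqrt (a^2 + x^2) \<ge> x, hence F(a,x) \<le> x / (a + x), at
  half-integers a.\<close>

lemma bessel_ratio_tail_upper:
  assumes "x > 0"
  shows "bessel_ratio (n + j) x \<le> bessel_ratio n x * (x ^ j / pochhammer (real n + x + 1 / 2) j)"
proof (induction j)
  case (Suc j)
  define a where "a = real (n + j) + 1 / 2"
  have a: "a > 0" by (simp add: a_def)
  have P: "pochhammer (real n + x + 1 / 2) j > 0"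
    using assms by (intro pochhammer_pos) simp
  have "x \<le> sqrt (a\<^sup>2 + x\<^sup>2)"
    by (rule real_sqrt_sum_squares_ge2)
  then have F: "F a x \<le> x / (a + x)"
    using a assms unfolding F_def
    by (intro divide_left_mono) (auto intro!: mult_pos_pos add_pos_nonneg)
  have "bessel_ratio (n + Suc j) x \<le> bessel_ratio (n + j) x * F a x"
    unfolding a_def using bessel_ratio_Suc_bounds(2)[OF assms, of "n + j"] by simp
  also have "\<dots> \<le> (bessel_ratio n x * (x ^ j / pochhammer (real n + x + 1 / 2) j)) * (x / (a + x))"
    using Suc F assms a P bessel_ratio_pos[OF assms, of n] F_pos[OF assms, of a]
    by (intro mult_mono) auto
  finally have "bessel_ratio (n + Suc j) x
      \<le> bessel_ratio n x * (x ^ j / pochhammer (real n + x + 1 / 2) j) * (x / (a + x))" .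
  moreover have "pochhammer (real n + x + 1 / 2) (Suc j) = pochhammer (real n + x + 1 / 2) j * (a + x)"
    by (simp add: pochhammer_Suc a_def algebra_simps)
  ultimately show ?case by (simp add: mult_ac)
qed simp

section \<open>The bounds on the sum of Bessel ratios\<close>

text \<open>
  The weights \<open>max 0 (\<surd>x - k/2)\<close> make the summands dominate a telescoping sum, because
  \<open>(\<surd>x - (k + 1))\<^sup>2 \<ge> 0\<close>.
\<close>
lemma sum_exp_triangular_ge:
  assumes "x \<ge> 1"
  shows "exp (- 1 / x) * (sqrt x - 1 / 2)
           - max 0 (sqrt x - (real m + 1) / 2) * exp (- ((real m + 1) * (real m + 2) / (2 * x)))
           \<le> (\<Sum>k=1..m. exp (- (real k * (real k + 1) / (2 * x))))"
proof (induction m)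
  case 0
  show ?case using assms by (simp add: max_def)
next
  case (Suc m)
  define u where "u = real m + 2"
  define s where "s = sqrt x"
  have s: "s > 0" "x = s\<^sup>2" using assms by (simp_all add: s_def)
  define e where "e = exp (- ((real m + 1) * (real m + 2) / (2 * x)))"
  define e' where "e' = exp (- ((real m + 2) * (real m + 3) / (2 * x)))"
  have e: "e > 0" by (simp add: e_def)
  have e': "e' = e * exp (- (u / x))"
    using assms by (simp add: e_def e'_def u_def field_simps flip: exp_add)
  \<comment> \<open>Dividing the induction step by the new summand leaves an inequality between
    consecutive weights. If s \<le> u/2, the next weight is 0 and the current one is at most 1/2;
    otherwise exp t \<ge> 1 + t is used.\<close>
  have "e * max 0 (s - (u - 1) / 2) \<le> e * (1 + max 0 (s - u / 2) * exp (- (u / x)))"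
  proof (rule mult_left_mono)
    show "max 0 (s - (u - 1) / 2) \<le> 1 + max 0 (s - u / 2) * exp (- (u / x))"
    proof (cases "s \<le> u / 2")
      case True
      then have "s - (u - 1) / 2 \<le> 1" by (simp add: diff_divide_distrib)
      then have "max 0 (s - (u - 1) / 2) \<le> 1" by (simp only: max.bounded_iff) simp
      moreover have "0 \<le> max 0 (s - u / 2) * exp (- (u / x))" by simp
      ultimately show ?thesis by linarith
    next
      case False
      have "0 \<le> (u - s)\<^sup>2" by simp
      then have "2 * u * (s - u / 2) \<le> x"
        by (simp add: s(2) power2_eq_square algebra_simps)
      then have "(s - u / 2) * (u / x) \<le> 1 / 2"
        using assms by (simp add: field_simps)
      moreover have "(s - u / 2) * (1 - u / x) \<le> (s - u / 2) * exp (- (u / x))"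
        using exp_ge_add_one_self[of "- (u / x)"] False by (intro mult_left_mono) auto
      moreover have "(s - u / 2) * (1 - u / x) = (s - u / 2) - (s - u / 2) * (u / x)"
        by (simp only: right_diff_distrib mult_1_right)
      moreover have "s - (u - 1) / 2 = s - u / 2 + 1 / 2"
        by (simp add: field_simps)
      ultimately have "s - (u - 1) / 2 \<le> 1 + (s - u / 2) * exp (- (u / x))"
        by linarith
      then show ?thesis using False by (simp add: max_def field_simps)
    qed
  qed (use e in simp)
  then have "e * max 0 (s - (real m + 1) / 2) \<le> e + max 0 (s - (real m + 2) / 2) * e'"
    unfolding e' by (simp add: u_def algebra_simps)
  then show ?case
    using Suc by (simp add: e_def e'_def s_def algebra_simps)
qed

section \<open>Numerical estimates for the first two terms of \<open>L0\<close>\<close>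

lemma sqrt_le_tangent:
  assumes "c > 0" "z \<ge> 0"
  shows "sqrt z \<le> (z / c + c) / 2"
proof -
  have "0 \<le> (sqrt z - c)\<^sup>2" by simp
  then have "2 * c * sqrt z \<le> z + c\<^sup>2"
    using assms by (simp add: power2_diff algebra_simps)
  then show ?thesis using assms by (simp add: field_simps power2_eq_square)
qed

text \<open>Cubing reduces this to 2.72^5 \<le> (27/5)^3. It is the value of exp (- 5/x) at x = 3,
  the critical end of the range for [x] = 2.\<close>

lemma exp_neg_five_thirds_ge: "exp (- 5 / 3) \<ge> (5 / 27 :: real)"
proof -
  have "exp 1 \<le> (2.72 :: real)"
    using e_approx_32 by (simp add: abs_if split: if_splits)
  then have "exp 1 ^ 5 \<le> (2.72 :: real) ^ 5"
    by (intro power_mono) auto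
  then have "exp (5 / 3) ^ 3 \<le> (27 / 5 :: real) ^ 3"
    by (simp add: power_divide flip: exp_of_nat_mult)
  then have "exp (5 / 3) \<le> (27 / 5 :: real)"
    by (rule power_le_imp_le_base[of _ 2, simplified]) auto
  then have "1 / (27 / 5) \<le> 1 / exp (5 / 3 :: real)"
    by (intro divide_left_mono) auto
  then show ?thesis by (simp add: exp_minus field_simps)
qed

lemma exp_neg_five_fourths_ge: "exp (- 5 / 4) \<ge> (1 / 4 :: real)"
proof -
  have "exp 1 \<le> (2.72 :: real)"
    using e_approx_32 by (simp add: abs_if split: if_splits)
  then have "exp 1 ^ 5 \<le> (2.72 :: real) ^ 5"
    by (intro power_mono) auto
  then have "exp (5 / 4) ^ 4 \<le> (4 :: real) ^ 4"
    by (simp add: power_divide flip: exp_of_nat_mult)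
  then have "exp (5 / 4) \<le> (4 :: real)"
    by (rule power_le_imp_le_base[of _ 3, simplified]) auto
  then have "1 / 4 \<le> 1 / exp (5 / 4 :: real)"
    by (intro divide_left_mono) auto
  then show ?thesis by (simp add: exp_minus field_simps)
qed

text \<open>For n \<ge> 5 the bound x < n + 1 gives sqrt x \<le> n/2, so the boundary weight in
  \<open>sum_exp_triangular_ge\<close> vanishes. It need not vanish for n = 3 and n = 4, where the
  few summands are estimated individually.\<close>

lemma sum_exp_triangular_ge_sqrt:
  assumes n: "n \<ge> 3" and x: "real n \<le> x" "x < real n + 1"
  shows "exp (- 1 / x) * (sqrt x - 1 / 2)
           \<le> (\<Sum>k=1..n - 1. exp (- (real k * (real k + 1) / (2 * x))))"
proof -
  have x3: "x \<ge> 3" using n x by simp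
  define e where "e = exp (- 1 / x)"
  have e: "e > 0" by (simp add: e_def)
  have e2: "exp (- (6 / (2 * x))) \<ge> e * (1 - 2 / x)"
  proof -
    have "exp (- (6 / (2 * x))) = e * exp (- 2 / x)"
      using x3 by (simp add: e_def field_simps flip: exp_add)
    moreover have "exp (- 2 / x) \<ge> 1 - 2 / x"
      using exp_ge_add_one_self[of "- 2 / x"] by simp
    ultimately show ?thesis using e by (simp add: mult_left_mono)
  qed
  \<comment> \<open>Tangent at 4, the point where the exceptional ranges [3,4) and [4,5)
    meet.\<close>
  have sq: "sqrt x \<le> x / 4 + 1"
    using sqrt_le_tangent[of 2 x] x3 by simp
  consider "n = 3" | "n = 4" | "n \<ge> 5" using n by linarith
  then show ?thesis
  proof cases
    case 1
    \<comment> \<open>This says that the convex function 2/x lies below its chord over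
      [3,4].\<close>
    have "(x - 3) * (x - 4) \<le> 0"
      using 1 x by (intro mult_nonneg_nonpos) auto
    then have "2 / x \<le> 7 / 6 - x / 6"
      using x3 by (simp add: field_simps)
    then have "sqrt x - 1 / 2 \<le> 1 + (1 - 2 / x)"
      using sq 1 x by simp
    then have "e * (sqrt x - 1 / 2) \<le> e * (1 + (1 - 2 / x))"
      using e by (intro mult_left_mono) auto
    also have "\<dots> \<le> e + exp (- (6 / (2 * x)))"
      using e2 by (simp add: algebra_simps)
    also have "\<dots> = (\<Sum>k=1..n - 1. exp (- (real k * (real k + 1) / (2 * x))))"
      using 1 by (simp add: e_def numeral_eq_Suc)
    finally show ?thesis by (simp add: e_def)
  next
    case 2
    have e3: "exp (- (12 / (2 * x))) \<ge> e * (1 / 4)"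
    proof -
      have "exp (- (12 / (2 * x))) = e * exp (- 5 / x)"
        using x3 by (simp add: e_def field_simps flip: exp_add)
      moreover have "exp (- 5 / x) \<ge> exp (- 5 / 4)"
        using 2 x by (simp add: field_simps)
      then have "exp (- 5 / x) \<ge> 1 / 4"
        using exp_neg_five_fourths_ge by linarith
      ultimately show ?thesis
        using e mult_left_mono[of "1 / 4" "exp (- 5 / x)" e] by simp
    qed
    have "2 / x \<le> 1 / 2" "x < 5"
      using 2 x by (simp_all add: field_simps)
    then have "sqrt x - 1 / 2 \<le> 1 + (1 - 2 / x) + 1 / 4"
      using sq by linarith
    then have "e * (sqrt x - 1 / 2) \<le> e * (1 + (1 - 2 / x) + 1 / 4)"
      using e by (intro mult_left_mono) auto
    also have "\<dots> = e + e * (1 - 2 / x) + e * (1 / 4)"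
      by (simp only: distrib_left mult_1_right)
    also have "\<dots> \<le> e + exp (- (6 / (2 * x))) + exp (- (12 / (2 * x)))"
      using e2 e3 by linarith
    also have "\<dots> = (\<Sum>k=1..n - 1. exp (- (real k * (real k + 1) / (2 * x))))"
      using 2 by (simp add: e_def numeral_eq_Suc)
    finally show ?thesis by (simp add: e_def)
  next
    case 3
    have "5 \<le> real n" using 3 by simp
    moreover from this have "5 * real n \<le> real n * real n"
      by (rule mult_right_mono) simp
    ultimately have "4 * x \<le> real n * real n"
      using x by linarith
    then have "x \<le> (real n / 2)\<^sup>2"
      by (simp add: power2_eq_square)
    then have "sqrt x \<le> real n / 2"
      by (intro real_le_lsqrt) (use x3 in auto)
    then show ?thesis
      using sum_exp_triangular_ge[of x "n - 1"] x3 3 by (simp add: of_nat_diff)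
  qed
qed

text \<open>
  The integral comparison would produce \<open>n(n + 1)\<close> and \<open>n + 1/2\<close> in the subtracted term, which is
  larger than the one here, so it does not prove this bound. For \<open>n \<ge> 3\<close> the sum already dominates
  the first term alone. For \<open>n = 2\<close> the bound is nearly attained as \<open>x \<rightarrow> 3\<close>, whence the explicit constants.
\<close>
lemma L0_head_le:
  assumes n: "n \<ge> 2" and x: "real n \<le> x" "x < real n + 1"
  shows "2 * x * exp (- 1 / x) / (3 / 2 + sqrt (9 / 4 + 4 * x))
       - 2 * x * exp (- (1 / (2 * x)) * (real n + 1) * (real n + 2))
           / (real n + 3 / 2 + sqrt ((real n + 3 / 2)\<^sup>2 + 8 * x / pi))
       \<le> (\<Sum>k=1..n - 1. exp (- (real k * (real k + 1) / (2 * x))))"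
proof -
  have x2: "x \<ge> 2" using n x by simp
  define A where "A = (sqrt (9 / 4 + 4 * x) - 3 / 2) / 2"
  have "(sqrt (9 / 4 + 4 * x) - 3 / 2) * (3 / 2 + sqrt (9 / 4 + 4 * x)) = (sqrt (9 / 4 + 4 * x))\<^sup>2 - 9 / 4"
    by (simp add: algebra_simps power2_eq_square)
  also have "\<dots> = 4 * x" using x2 by simp
  finally have A: "A * (3 / 2 + sqrt (9 / 4 + 4 * x)) = 2 * x"
    by (simp add: A_def)
  moreover have "3 / 2 + sqrt (9 / 4 + 4 * x) > 0"
    using x2 by (intro add_pos_nonneg) auto
  ultimately have first: "2 * x * exp (- 1 / x) / (3 / 2 + sqrt (9 / 4 + 4 * x)) = exp (- 1 / x) * A"
    by (simp flip: A)
  show ?thesis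
  proof (cases "n = 2")
    case False
    have "sqrt (9 / 4 + 4 * x) \<le> 2 * sqrt x + 1 / 2"
    proof (rule real_le_lsqrt)
      have "(2 * sqrt x + 1 / 2)\<^sup>2 = 4 * x + 2 * sqrt x + 1 / 4"
        using x2 by (simp add: power2_sum power_mult_distrib power_divide)
      moreover have "1 \<le> sqrt x" using x2 by simp
      ultimately show "9 / 4 + 4 * x \<le> (2 * sqrt x + 1 / 2)\<^sup>2" by linarith
    qed (use x2 in auto)
    then have "exp (- 1 / x) * A \<le> exp (- 1 / x) * (sqrt x - 1 / 2)"
      by (intro mult_left_mono) (auto simp: A_def)
    also have "\<dots> \<le> (\<Sum>k=1..n - 1. exp (- (real k * (real k + 1) / (2 * x))))"
      using False n x by (intro sum_exp_triangular_ge_sqrt) auto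
    finally have "exp (- 1 / x) * A \<le> (\<Sum>k=1..n - 1. exp (- (real k * (real k + 1) / (2 * x))))" .
    moreover have "0 \<le> 2 * x * exp (- (1 / (2 * x)) * (real n + 1) * (real n + 2))
           / (real n + 3 / 2 + sqrt ((real n + 3 / 2)\<^sup>2 + 8 * x / pi))"
      using x2 by (intro divide_nonneg_nonneg add_nonneg_nonneg) auto
    ultimately show ?thesis unfolding first by linarith
  next
    case True
    \<comment> \<open>For n = 2 the sum is the single term exp (- 1/x). Taking this factor out of
      everything leaves A - B \<le> 1.\<close>
    define B where "B = 2 * x * exp (- 5 / x) / (7 / 2 + sqrt (49 / 4 + 8 * x / pi))"
    have B0: "B \<ge> 0"
      unfolding B_def using x2 by (intro divide_nonneg_nonneg add_nonneg_nonneg) auto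
    have second: "2 * x * exp (- (1 / (2 * x)) * (real n + 1) * (real n + 2))
           / (real n + 3 / 2 + sqrt ((real n + 3 / 2)\<^sup>2 + 8 * x / pi)) = exp (- 1 / x) * B"
    proof -
      have "- (1 / (2 * x)) * (real n + 1) * (real n + 2) = - 1 / x + - 5 / x"
        using True x2 by (simp add: field_simps)
      then have "exp (- (1 / (2 * x)) * (real n + 1) * (real n + 2)) = exp (- 1 / x) * exp (- 5 / x)"
        by (simp only: exp_add)
      then show ?thesis
        using True by (simp add: B_def power2_eq_square)
    qed
    have "A - B \<le> 1"
    \<comment> \<open>A \<le> 1 holds exactly up to x = 5/2; beyond that B has to
      compensate.\<close>
    proof (cases "x \<le> 5 / 2")
      case le: True
      have "sqrt (9 / 4 + 4 * x) \<le> 7 / 2"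
        using le x2 by (intro real_le_lsqrt) (auto simp: power2_eq_square)
      then have "A \<le> (7 / 2 - 3 / 2) / 2"
        unfolding A_def by (intro divide_right_mono diff_right_mono) auto
      then show ?thesis using B0 by simp
    next
      case False
      have x3: "5 / 2 < x" "x < 3" using False True x by auto
      \<comment> \<open>151/40 approximates sqrt (9/4 + 12), so this is nearly the tangent at x = 3.
        The bound for B below is also linear in x and uses exp linearised at x = 3, which makes the
        final comparison linear.\<close>
      have A: "A \<le> (((9 / 4 + 4 * x) / (151 / 40) + 151 / 40) / 2 - 3 / 2) / 2"
        unfolding A_def
        by (intro divide_right_mono diff_right_mono sqrt_le_tangent) (use x2 in auto)
      have "8 * x / pi \<le> 8"
        using pi_gt3 x3 by (simp add: field_simps)
      then have "sqrt (49 / 4 + 8 * x / pi) \<le> 9 / 2"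
        using x3 by (intro real_le_lsqrt) (auto simp: power2_eq_square)
      then have den: "7 / 2 + sqrt (49 / 4 + 8 * x / pi) \<le> 8" by simp
      have "exp (- 5 / x) = exp (- 5 / 3) * exp (5 / 3 - 5 / x)"
        by (simp flip: exp_add)
      also have "\<dots> \<ge> 5 / 27 * (8 / 3 - 5 / x)"
      proof (rule mult_mono)
        show "8 / 3 - 5 / x \<le> exp (5 / 3 - 5 / x)"
          using exp_ge_add_one_self[of "5 / 3 - 5 / x"] by simp
      qed (use x3 exp_neg_five_thirds_ge in \<open>auto simp: field_simps\<close>)
      finally have "2 * x * (5 / 27 * (8 / 3 - 5 / x)) \<le> 2 * x * exp (- 5 / x)"
        using x3 by (intro mult_left_mono) auto
      moreover have "2 * x * (5 / 27 * (8 / 3 - 5 / x)) = 5 / 27 * (16 / 3 * x - 10)"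
        using x3 by (simp add: field_simps)
      ultimately have num: "5 / 27 * (16 / 3 * x - 10) \<le> 2 * x * exp (- 5 / x)"
        by simp
      have "5 / 27 * (16 / 3 * x - 10) / 8 \<le> B"
        unfolding B_def using num den x3
        by (intro frac_le) (auto intro!: add_pos_nonneg)
      then show ?thesis using A x3 by argo
    qed
    then have "exp (- 1 / x) * (A - B) \<le> exp (- 1 / x) * 1"
      by (intro mult_left_mono) auto
    also have "\<dots> = (\<Sum>k=1..n - 1. exp (- (real k * (real k + 1) / (2 * x))))"
      using True by simp
    finally show ?thesis unfolding first second by (simp add: algebra_simps)
  qed
qed

lemma L0_le:
  assumes "x > 0"
  shows "L0 x \<le> bessel_ratio_sum x"
proof (cases "\<lfloor>x\<rfloor> \<ge> 2")
  case False
  then show ?thesis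
    using bessel_ratio_sum_lower[OF assms, of 0] assms by (simp add: L0_def bessel_ratio_0)
next
  case True
  define n where "n = nat \<lfloor>x\<rfloor>"
  have n: "real_of_int \<lfloor>x\<rfloor> = real n" "n \<ge> 2" using True unfolding n_def by (simp, linarith)
  then have x: "real n \<le> x" "x < real n + 1" by linarith+
  have m: "real (n - 1) = real n - 1" using n by (simp add: of_nat_diff)
  have "exp (- ((real n - 1) * real n / (2 * x))) \<le> bessel_ratio (n - 1) x"
    using exp_le_bessel_ratio[OF assms, of "n - 1"] unfolding m by simp
  then have "exp (- ((real n - 1) * real n / (2 * x))) * (F n x * (1 + F (real n + 1) x))
      \<le> bessel_ratio (n - 1) x * (F n x * (1 + F (real n + 1) x))"
    using F_pos[OF assms, of n] F_pos[OF assms, of "real n + 1"]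
    by (intro mult_right_mono) simp_all
  moreover have "(\<Sum>k=1..n - 1. exp (- (real k * (real k + 1) / (2 * x))))
      \<le> (\<Sum>k=1..n - 1. bessel_ratio k x)"
    by (intro sum_mono exp_le_bessel_ratio assms)
  moreover have "(\<Sum>k=1..n - 1. bessel_ratio k x)
      + bessel_ratio (n - 1) x * (F n x * (1 + F (real n + 1) x)) \<le> bessel_ratio_sum x"
    using bessel_ratio_sum_lower[OF assms, of "n - 1"] unfolding m by (simp add: add.commute)
  moreover have "L0 x = 2 * x * exp (- 1 / x) / (3 / 2 + sqrt (9 / 4 + 4 * x))
       - 2 * x * exp (- (1 / (2 * x)) * (real n + 1) * (real n + 2))
           / (real n + 3 / 2 + sqrt ((real n + 3 / 2)\<^sup>2 + 8 * x / pi))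
       + exp (- ((real n - 1) * real n / (2 * x))) * (F n x * (1 + F (real n + 1) x))"
    using True by (simp add: L0_def Let_def n(1))
  ultimately show ?thesis using L0_head_le[OF n(2) x] by linarith
qed

text \<open>Ensures that the denominator 1 + 2 \<open>L0 x\<close> in the upper bounds is positive.
  The subtracted fraction has the smaller numerator and, because pi < 4, the larger
  denominator.\<close>

lemma L0_nonneg:
  assumes "x > 0"
  shows "L0 x \<ge> 0"
proof (cases "\<lfloor>x\<rfloor> \<ge> 2")
  case False
  then show ?thesis
    using F_pos[OF assms, of 1] F_pos[OF assms, of 2] by (simp add: L0_def)
next
  case True
  define n where "n = real_of_int \<lfloor>x\<rfloor>"
  have n: "n \<ge> 2" "x < n + 1" using True by (simp_all add: n_def)
  have "2 * x * exp (- (1 / (2 * x)) * (n + 1) * (n + 2)) / (n + 3 / 2 + sqrt ((n + 3 / 2)\<^sup>2 + 8 * x / pi))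
      \<le> 2 * x * exp (- 1 / x) / (3 / 2 + sqrt (9 / 4 + 4 * x))"
  proof (rule frac_le)
    have "1 * 2 \<le> (n + 1) * (n + 2)" using n by (intro mult_mono) auto
    then show "2 * x * exp (- (1 / (2 * x)) * (n + 1) * (n + 2)) \<le> 2 * x * exp (- 1 / x)"
      using assms by (simp add: field_simps)
    have "2 * n \<le> n * n" using n by (intro mult_right_mono) auto
    then have "2 * x \<le> n * n + 3 * n" using n by linarith
    moreover have "8 * x / pi \<ge> 2 * x" using assms pi_less_4 by (simp add: field_simps)
    ultimately have "9 / 4 + 4 * x \<le> (n + 3 / 2)\<^sup>2 + 8 * x / pi"
      by (simp add: power2_eq_square algebra_simps)
    then have "sqrt (9 / 4 + 4 * x) \<le> sqrt ((n + 3 / 2)\<^sup>2 + 8 * x / pi)" by simp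
    then show "3 / 2 + sqrt (9 / 4 + 4 * x) \<le> n + 3 / 2 + sqrt ((n + 3 / 2)\<^sup>2 + 8 * x / pi)"
      using n by linarith
    show "0 < 3 / 2 + sqrt (9 / 4 + 4 * x)"
      using assms by (intro add_pos_nonneg) auto
  qed (use assms in auto)
  moreover have "0 \<le> exp (- ((n - 1) * n / (2 * x))) * F n x * (1 + F (n + 1) x)"
    using F_pos[OF assms, of n] F_pos[OF assms, of "n + 1"] n by simp
  ultimately show ?thesis using True by (simp add: L0_def n_def Let_def)
qed

lemma le_U0:
  assumes "x > 0"
  shows "bessel_ratio_sum x \<le> U0 x"
proof (cases "\<lfloor>x\<rfloor> \<ge> 2")
  case False
  then show ?thesis
    using bessel_ratio_sum_upper[OF assms, of 0] assms by (simp add: U0_def bessel_ratio_0)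
next
  case True
  define n where "n = nat \<lfloor>x\<rfloor>"
  have n: "real_of_int \<lfloor>x\<rfloor> = real n" "n \<ge> 2" using True unfolding n_def by (simp, linarith)
  then have x: "real n \<le> x" by linarith
  have m: "real (n - 1) = real n - 1" using n by (simp add: of_nat_diff)
  \<comment> \<open>The mesh for which exp (- (b k)^2) is the Gaussian bound on the k-th
    ratio.\<close>
  define b where "b = sqrt (alpha0 / (2 * x))"
  have b: "b > 0" "b\<^sup>2 = alpha0 / (2 * x)"
    using assms alpha0_pos by (simp_all add: b_def)
  have a0: "alpha0 = 2 * x * b\<^sup>2" using b assms by simp
  have "(\<Sum>k=1..n - 1. bessel_ratio k x) \<le> (\<Sum>k=1..n - 1. exp (- (b * real k)\<^sup>2))"
  proof (rule sum_mono)
    fix k assume "k \<in> {1..n - 1}"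
    then have "real k \<le> x" using x n by auto
    from bessel_ratio_le_exp[OF assms this]
    show "bessel_ratio k x \<le> exp (- (b * real k)\<^sup>2)"
      by (simp add: power_mult_distrib b(2))
  qed
  also have "\<dots> \<le> gauss_int (b * real (n - 1)) / b"
    using sum_exp_le_gauss_int[OF b(1), of "n - 1"] b(1) by (simp add: field_simps)
  \<comment> \<open>The upper limit is enlarged from b (n - 1) to b x because the tail term in
    \<open>U0\<close> is the Mills bound at b x.\<close>
  also have "\<dots> \<le> gauss_int (b * x) / b"
    using b(1) x by (intro divide_right_mono gauss_int_mono mult_left_mono) (auto simp: m)
  also have "\<dots> \<le> (sqrt pi / 2 - mills (b * x)) / b"
    using b(1) gauss_int_plus_mills_le[of "b * x"] assms by (intro divide_right_mono) auto
  also have "\<dots> = 2 * x / alpha0 *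
         (1 / sqrt (8 * x / (pi * alpha0))
          - exp (- (alpha0 * x / 2)) / (x + sqrt (x\<^sup>2 + 4 * x / alpha0)))"
  proof -
    define q where "q = x + sqrt (x\<^sup>2 + 4 * x / alpha0)"
    have q: "q > 0"
      unfolding q_def using assms alpha0_pos by (intro add_pos_nonneg) auto
    have "8 * x / (pi * alpha0) = (2 / b)\<^sup>2 / pi"
      unfolding a0 using assms by (simp add: power2_eq_square)
    then have root: "sqrt (8 * x / (pi * alpha0)) = 2 / b / sqrt pi"
      using b(1) by (simp add: real_sqrt_divide del: power_divide)
    have sq: "(b * x)\<^sup>2 = alpha0 * x / 2"
      unfolding a0 by (simp add: power2_eq_square)
    have "(b * x)\<^sup>2 + 2 = b\<^sup>2 * (x\<^sup>2 + 4 * x / alpha0)"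
      unfolding a0 using b(1) assms by (simp add: field_simps power2_eq_square)
    then have "sqrt ((b * x)\<^sup>2 + 2) = b * sqrt (x\<^sup>2 + 4 * x / alpha0)"
      using b(1) by (simp only: real_sqrt_mult real_sqrt_abs abs_of_pos)
    then have "b * x + sqrt ((b * x)\<^sup>2 + 2) = b * q"
      by (simp only: q_def distrib_left)
    then have mills: "mills (b * x) = exp (- (alpha0 * x / 2)) / (b * q)"
      by (simp only: mills_def sq)
    have coeff: "2 * x / alpha0 = 1 / b\<^sup>2"
      unfolding a0 using assms by simp
    show ?thesis
      unfolding mills root coeff q_def [symmetric]
      using b(1) q by (simp add: power2_eq_square field_simps)
  qed
  finally have *: "(\<Sum>k=1..n - 1. bessel_ratio k x) \<le> \<dots>" .
  have "F (real n + 1 / 2) x < 1" using n by (intro F_less_1 assms) simp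
  then have "0 \<le> F (real n - 1 / 2) x / (1 - F (real n + 1 / 2) x)"
    using F_pos[OF assms, of "real n - 1 / 2"] n by (intro divide_nonneg_nonneg) auto
  then have "bessel_ratio (n - 1) x * (F (real n - 1 / 2) x / (1 - F (real n + 1 / 2) x))
      \<le> exp (- (alpha0 / (2 * x)) * (real n - 1)\<^sup>2) * (F (real n - 1 / 2) x / (1 - F (real n + 1 / 2) x))"
    using bessel_ratio_le_exp[OF assms, of "n - 1"] x m by (intro mult_right_mono) auto
  moreover have "real (n - 1) + 1 / 2 = real n - 1 / 2" "real (n - 1) + 3 / 2 = real n + 1 / 2"
    using m by auto
  then have "bessel_ratio_sum x \<le> (\<Sum>k=1..n - 1. bessel_ratio k x)
      + bessel_ratio (n - 1) x * (F (real n - 1 / 2) x / (1 - F (real n + 1 / 2) x))"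
    using bessel_ratio_sum_upper[OF assms, of "n - 1"] by metis
  moreover have "U0 x = 2 * x / alpha0 *
         (1 / sqrt (8 * x / (pi * alpha0))
          - exp (- (alpha0 * x / 2)) / (x + sqrt (x\<^sup>2 + 4 * x / alpha0)))
       + exp (- (alpha0 / (2 * x)) * (real n - 1)\<^sup>2)
         * (F (real n - 1 / 2) x / (1 - F (real n + 1 / 2) x))"
    using True by (simp only: U0_def Let_def n(1) if_True)
  ultimately show ?thesis using * by linarith
qed

section \<open>The Skellam probabilities\<close>

lemma pmf_skellam_bessel_ratio:
  assumes "lam1 > 0" "lam2 > 0"
    and x: "x = 2 * sqrt (lam1 * lam2)"
    and C: "C = sqrt (lam1 / lam2) ^ n * exp (- (sqrt lam1 - sqrt lam2)\<^sup>2)"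
  shows "pmf (skellam_pmf lam1 lam2) (int n) =
           C * (bessel_ratio n x / (1 + 2 * bessel_ratio_sum x))"
proof -
  have x0: "x > 0" using assms by simp
  define S where "S = bessel_S n (lam1 * lam2)"
  have I: "bessel_I n x = sqrt (lam1 * lam2) ^ n * S"
    using assms by (simp add: bessel_I_def S_def)
  have "lam1 = sqrt (lam1 / lam2) * sqrt (lam1 * lam2)"
    using assms by (simp add: real_sqrt_divide real_sqrt_mult)
  then have l: "lam1 ^ n = sqrt (lam1 / lam2) ^ n * sqrt (lam1 * lam2) ^ n"
    by (metis power_mult_distrib)
  have "- (lam1 + lam2) = - (sqrt lam1 - sqrt lam2)\<^sup>2 + - x"
    using assms by (simp add: power2_diff real_sqrt_mult)
  then have e: "exp (- (lam1 + lam2)) = exp (- (sqrt lam1 - sqrt lam2)\<^sup>2) * exp (- x)"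
    by (simp only: exp_add)
  have "pmf (skellam_pmf lam1 lam2) (int n) = C * (exp (- x) * bessel_I n x)"
    unfolding pmf_skellam[OF assms(1,2)] S_def [symmetric] e l C I by (simp only: mult_ac)
  also have "exp (- x) * bessel_I n x = bessel_ratio n x / (1 + 2 * bessel_ratio_sum x)"
    unfolding bessel_ratio_sums(2)[OF x0] using bessel_I_pos[OF x0, of 0]
    by (simp add: bessel_ratio_def exp_minus field_simps)
  finally show ?thesis .
qed

theorem mainTheorem5:
  fixes M :: "'a measure" and W :: "'a \<Rightarrow> int"
    and lam1 lam2 x C :: real and \<nu> N :: nat
  assumes "lam1 > 0" and "lam2 > 0"
    and "prob_space M"
    and "W \<in> measurable M (count_space UNIV)"
    and "distr M (count_space UNIV) W = measure_pmf (skellam_pmf lam1 lam2)"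
    and "x = 2 * sqrt (lam1 * lam2)"
    and "C = sqrt (lam1 / lam2) ^ \<nu> * exp (- (sqrt lam1 - sqrt lam2)\<^sup>2)"
    and "N = nat \<lfloor>x\<rfloor>"
  shows "(real \<nu> \<le> x \<longrightarrow>
            C * (exp (- (real \<nu> * (real \<nu> + 1) / (2 * x))) / (1 + 2 * U0 x))
              \<le> measure M {\<omega> \<in> space M. W \<omega> = int \<nu>} \<and>
            measure M {\<omega> \<in> space M. W \<omega> = int \<nu>}
              \<le> C * (exp (- (alpha0 / (2 * x)) * (real \<nu>)\<^sup>2) / (1 + 2 * L0 x)))
       \<and> (real \<nu> > x \<longrightarrow>
            C * (exp (- (real N * (real N + 1) / (2 * x)))
                   * Beta (real N + x / 2 + 1) (real \<nu> - real N)
                   * ((x / 2) ^ (\<nu> - N) / fact (\<nu> - N - 1))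
                 / (1 + 2 * U0 x))
              \<le> measure M {\<omega> \<in> space M. W \<omega> = int \<nu>} \<and>
            measure M {\<omega> \<in> space M. W \<omega> = int \<nu>}
              \<le> C * (exp (- (alpha0 / (2 * x)) * (real N)\<^sup>2)
                   * Beta (real N + x + 1 / 2) (real \<nu> - real N)
                   * (x ^ (\<nu> - N) / fact (\<nu> - N - 1))
                 / (1 + 2 * L0 x)))"
proof -
  have x0: "x > 0" using assms(1,2,6) by simp
  have C0: "C \<ge> 0" using assms(1,2,7) by simp
  have "measure M {\<omega> \<in> space M. W \<omega> = int \<nu>} = measure (distr M (count_space UNIV) W) {int \<nu>}"
    using assms(4) by (subst measure_distr) (auto intro!: arg_cong[where f = "measure M"])
  also have "\<dots> = pmf (skellam_pmf lam1 lam2) (int \<nu>)"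
    unfolding assms(5) by (simp add: measure_pmf_single)
  finally have P: "measure M {\<omega> \<in> space M. W \<omega> = int \<nu>} =
      C * (bessel_ratio \<nu> x / (1 + 2 * bessel_ratio_sum x))"
    by (simp only: pmf_skellam_bessel_ratio[OF assms(1,2,6,7)])
  define H where "H = bessel_ratio_sum x"
  have L: "0 \<le> L0 x" "L0 x \<le> H" and U: "H \<le> U0 x"
    using L0_nonneg[OF x0] L0_le[OF x0] le_U0[OF x0] by (simp_all add: H_def)
  have R: "0 \<le> bessel_ratio \<nu> x" using bessel_ratio_pos[OF x0, of \<nu>] by simp
  have lower: "C * (r / (1 + 2 * U0 x)) \<le> measure M {\<omega> \<in> space M. W \<omega> = int \<nu>}"
    if "r \<le> bessel_ratio \<nu> x" for r
  proof -
    have "r / (1 + 2 * U0 x) \<le> bessel_ratio \<nu> x / (1 + 2 * U0 x)"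
      using that L U by (intro divide_right_mono) auto
    also have "\<dots> \<le> bessel_ratio \<nu> x / (1 + 2 * H)"
      using R L U by (intro divide_left_mono mult_pos_pos) auto
    finally show ?thesis
      unfolding P H_def [symmetric] using C0 by (intro mult_left_mono)
  qed
  have upper: "measure M {\<omega> \<in> space M. W \<omega> = int \<nu>} \<le> C * (r / (1 + 2 * L0 x))"
    if "bessel_ratio \<nu> x \<le> r" for r
    unfolding P H_def [symmetric] using C0 R L that
    by (intro mult_left_mono frac_le) auto
  show ?thesis
  proof (intro conjI impI)
    assume "real \<nu> \<le> x"
    then show "measure M {\<omega> \<in> space M. W \<omega> = int \<nu>}
        \<le> C * (exp (- (alpha0 / (2 * x)) * (real \<nu>)\<^sup>2) / (1 + 2 * L0 x))"
      by (intro upper bessel_ratio_le_exp x0)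
    show "C * (exp (- (real \<nu> * (real \<nu> + 1) / (2 * x))) / (1 + 2 * U0 x))
        \<le> measure M {\<omega> \<in> space M. W \<omega> = int \<nu>}"
      by (intro lower exp_le_bessel_ratio x0)
  next
    assume gt: "real \<nu> > x"
    have Nx: "real N \<le> x" using x0 assms(8) by simp
    then have N: "N < \<nu>" using gt by simp
    \<comment> \<open>The ratio of order \<nu> is reached in two stages: exponential bounds up to
      order N = [x], rational bounds for the remaining j factors.\<close>
    define j where "j = \<nu> - N"
    have j: "j > 0" "real \<nu> - real N = real j" "N + j = \<nu>"
      using N by (simp_all add: j_def of_nat_diff)
    have Beta: "Beta c (real j) * (y ^ j / fact (j - 1)) = y ^ j / pochhammer c j" if "c > 0" for c y :: real
      using Beta_of_nat[OF that j(1)] by (simp add: field_simps)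
    show "C * (exp (- (real N * (real N + 1) / (2 * x)))
                   * Beta (real N + x / 2 + 1) (real \<nu> - real N)
                   * ((x / 2) ^ (\<nu> - N) / fact (\<nu> - N - 1))
                 / (1 + 2 * U0 x))
              \<le> measure M {\<omega> \<in> space M. W \<omega> = int \<nu>}"
    proof (rule lower)
      define c where "c = real N + x / 2 + 1"
      have c: "c > 0" using x0 by (simp add: c_def add_pos_pos)
      have "exp (- (real N * (real N + 1) / (2 * x))) * ((x / 2) ^ j / pochhammer c j)
          \<le> bessel_ratio N x * ((x / 2) ^ j / pochhammer c j)"
        using x0 pochhammer_pos[OF c, of j]
        by (intro mult_right_mono exp_le_bessel_ratio) auto
      also have "\<dots> \<le> bessel_ratio \<nu> x"
        using bessel_ratio_tail_lower[OF x0, of N j] by (simp add: j c_def)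
      finally show "exp (- (real N * (real N + 1) / (2 * x)))
            * Beta (real N + x / 2 + 1) (real \<nu> - real N)
            * ((x / 2) ^ (\<nu> - N) / fact (\<nu> - N - 1)) \<le> bessel_ratio \<nu> x"
        by (simp only: j(2) j_def [symmetric] c_def [symmetric] mult.assoc Beta[OF c])
    qed
    show "measure M {\<omega> \<in> space M. W \<omega> = int \<nu>}
              \<le> C * (exp (- (alpha0 / (2 * x)) * (real N)\<^sup>2)
                   * Beta (real N + x + 1 / 2) (real \<nu> - real N)
                   * (x ^ (\<nu> - N) / fact (\<nu> - N - 1))
                 / (1 + 2 * L0 x))"
    proof (rule upper)
      define c where "c = real N + x + 1 / 2"
      have c: "c > 0" using x0 by (simp add: c_def add_pos_pos)
      have "bessel_ratio \<nu> x \<le> bessel_ratio N x * (x ^ j / pochhammer c j)"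
        using bessel_ratio_tail_upper[OF x0, of N j] by (simp add: j c_def)
      also have "\<dots> \<le> exp (- (alpha0 / (2 * x)) * (real N)\<^sup>2) * (x ^ j / pochhammer c j)"
        using x0 pochhammer_pos[OF c, of j] Nx
        by (intro mult_right_mono bessel_ratio_le_exp) auto
      finally show "bessel_ratio \<nu> x \<le> exp (- (alpha0 / (2 * x)) * (real N)\<^sup>2)
            * Beta (real N + x + 1 / 2) (real \<nu> - real N)
            * (x ^ (\<nu> - N) / fact (\<nu> - N - 1))"
        by (simp only: j(2) j_def [symmetric] c_def [symmetric] mult.assoc Beta[OF c])
    qed
  qed
qed

end
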